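(* Let $m \geq 1$ be an integer. Then \[ I(C_{m,3}) \simeq \begin{cases} S^{2m/3-1} & \text{if } m \equiv 0 \pmod 3,\\ \bigvee_2 S^{2(m-1)/3} & \text{if } m \equiv 1 \pmod 3,\\ S^{2(m-2)/3+1} & \text{if } m \equiv 2 \pmod 3, \end{cases} \] and \[ Z(C_{m,3}) = \begin{cases} 1 & \text{if } m \equiv 0 \pmod 3,\\ -2 & \text{if } m \equiv 1 \pmod 3,\\ 1 & \text{if } m \equiv 2 \pmod 3. \end{cases} \]
   Context: For integers $m\ge 1$, $n \geq 2$, $C_{m,n}$ is the graph with vertex set $\{1,\dots,m\}\times\{1,\dots,n\}$ in which distinct vertices $(i,j)$ and $(i',j')$ are adjacent if and only if either $i=i'$ and $j-j' \equiv \pm 1 \pmod n$, or $j=j'$ and $|i-i'|=1$. For a finite simple graph $G$, the independence complex $I(G)$ is the simplicial complex on the ground set $V(G)$ whose faces are all independent sets of $G$ (including $\emptyset$), and $Z(G) = \sum_{\sigma \in I(G)} (-1)^{|\sigma|}$. $\simeq$ denotes homotopy equivalence (of geometric realizations), $S^d$ is the $d$-dimensional sphere, and $\bigvee_k S^d$ is a wedge of $k$ copies of $S^d$. *)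

theory Defs
  imports
    "HOL-Analysis.Analysis"
    "HOL-Number_Theory.Cong"
    "Graph_Theory.Pair_Digraph"
begin

text \<open>
  A finite simple graph is a \<open>pair_graph\<close>: a finite loop-free digraph without parallel arcs
  whose set of arcs is symmetric, so that each edge \<open>uv\<close> is represented by the two arcs
  \<open>(u, v)\<close> and \<open>(v, u)\<close>.
\<close>

definition cylinder_graph :: "nat \<Rightarrow> nat \<Rightarrow> (nat \<times> nat) pair_pre_digraph" where
  "cylinder_graph m n =
     (let V = {1..m} \<times> {1..n} in
      \<lparr> pverts = V,
        parcs = {((i, j), (i', j')).
          (i, j) \<in> V \<and> (i', j') \<in> V \<and> (i, j) \<noteq> (i', j') \<and>
          (i = i' \<and> ([int j - int j' = 1] (mod int n) \<or> [int j - int j' = - 1] (mod int n)) \<or>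
           j = j' \<and> \<bar>int i - int i'\<bar> = 1)} \<rparr>)"

lemma pair_graph_cylinder_graph: "pair_graph (cylinder_graph m n)"
proof
  let ?V = "{1..m} \<times> {1..n}"
  show "finite (pverts (cylinder_graph m n))"
    by (simp add: cylinder_graph_def)
  have "parcs (cylinder_graph m n) \<subseteq> ?V \<times> ?V"
    by (auto simp: cylinder_graph_def Let_def)
  then show "finite (parcs (cylinder_graph m n))"
    by (rule finite_subset) simp
  have neg: "[int j' - int j = - k] (mod int n)" if "[int j - int j' = k] (mod int n)" for j j' k
    using that by (metis cong_minus_minus_iff minus_diff_eq)
  show "symmetric (with_proj (cylinder_graph m n))"
    unfolding symmetric_def
    by (rule symI) (auto simp: cylinder_graph_def Let_def abs_minus_commute dest: neg)
qed (auto simp: cylinder_graph_def Let_def)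

definition independence_complex :: "'a pair_pre_digraph \<Rightarrow> 'a set set" where
  "independence_complex G =
     {\<sigma>. \<sigma> \<subseteq> pverts G \<and> (\<forall>u\<in>\<sigma>. \<forall>v\<in>\<sigma>. (u, v) \<notin> parcs G)}"

definition independence_Z :: "'a pair_pre_digraph \<Rightarrow> int" where
  "independence_Z G = (\<Sum>\<sigma>\<in>independence_complex G. (- 1) ^ card \<sigma>)"

text \<open>
  Points of the geometric realization of an abstract simplicial complex \<open>K\<close> are given by their
  barycentric coordinates. The empty face and infinite sets contribute no point, because the sum
  over the support is then \<open>0\<close>. The topology is that of pointwise convergence of the coordinates;
  for a finite complex, which is the only case in which we use it, this is the usual topology.
\<close>

definition geometric_realization :: "'a set set \<Rightarrow> ('a \<Rightarrow> real) topology" where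
  "geometric_realization K =
     subtopology (powertop_real UNIV)
       {x. (\<forall>v. 0 \<le> x v) \<and> {v. x v \<noteq> 0} \<in> K \<and> (\<Sum>v | x v \<noteq> 0. x v) = 1}"

text \<open>
  The wedge of the pointed spaces \<open>(X i, p i)\<close>, \<open>i \<in> I\<close>: the quotient of their disjoint sum in
  which all base points are identified to the single point \<open>None\<close>. The wedge of the empty
  family is a point.
\<close>

definition wedge_map :: "('i \<Rightarrow> 'a) \<Rightarrow> 'i \<times> 'a \<Rightarrow> ('i \<times> 'a) option" where
  "wedge_map p = (\<lambda>(i, x). if x = p i then None else Some (i, x))"

definition wedge :: "('i \<Rightarrow> 'a topology) \<Rightarrow> ('i \<Rightarrow> 'a) \<Rightarrow> 'i set \<Rightarrow> ('i \<times> 'a) option topology" where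
  "wedge X p I =
     topology (\<lambda>U. U \<subseteq> insert None (wedge_map p ` topspace (sum_topology X I)) \<and>
       openin (sum_topology X I) {z \<in> topspace (sum_topology X I). wedge_map p z \<in> U})"

lemma openin_wedge:
  "openin (wedge X p I) U \<longleftrightarrow>
     U \<subseteq> insert None (wedge_map p ` topspace (sum_topology X I)) \<and>
     openin (sum_topology X I) {z \<in> topspace (sum_topology X I). wedge_map p z \<in> U}"
proof -
  let ?S = "sum_topology X I"
  let ?pre = "\<lambda>U. {z \<in> topspace ?S. wedge_map p z \<in> U}"
  have 1: "?pre (U \<inter> V) = ?pre U \<inter> ?pre V" for U V by blast
  have 2: "?pre (\<Union>\<K>) = \<Union> (?pre ` \<K>)" for \<K> by blast
  have "istopology (\<lambda>U. U \<subseteq> insert None (wedge_map p ` topspace ?S) \<and> openin ?S (?pre U))"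
    unfolding istopology_def
  proof (intro conjI allI impI)
    fix \<K> assume "\<forall>K\<in>\<K>. K \<subseteq> insert None (wedge_map p ` topspace ?S) \<and> openin ?S (?pre K)"
    then show "\<Union>\<K> \<subseteq> insert None (wedge_map p ` topspace ?S)" and "openin ?S (?pre (\<Union>\<K>))"
      unfolding 2 by (blast, intro openin_Union, blast)
  qed (unfold 1, blast, blast intro: openin_Int)
  then show ?thesis
    by (simp add: wedge_def)
qed

lemma quotient_map_wedge:
  assumes "I \<noteq> {}" and "\<And>i. i \<in> I \<Longrightarrow> p i \<in> topspace (X i)"
  shows "quotient_map (sum_topology X I) (wedge X p I) (wedge_map p)"
proof -
  let ?S = "sum_topology X I"
  obtain i where "i \<in> I" using assms(1) by blast
  then have "(i, p i) \<in> topspace ?S" "wedge_map p (i, p i) = None"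
    using assms(2) by (auto simp: wedge_map_def)
  then have ins: "insert None (wedge_map p ` topspace ?S) = wedge_map p ` topspace ?S"
    by (metis image_eqI insert_absorb)
  have "{z \<in> topspace ?S. wedge_map p z \<in> wedge_map p ` topspace ?S} = topspace ?S"
    by blast
  then have "openin (wedge X p I) (wedge_map p ` topspace ?S)"
    by (simp only: openin_wedge ins openin_topspace subset_refl simp_thms)
  then have "wedge_map p ` topspace ?S \<subseteq> topspace (wedge X p I)"
    by (rule openin_subset)
  moreover have "topspace (wedge X p I) \<subseteq> wedge_map p ` topspace ?S"
    using openin_wedge[THEN iffD1, OF openin_topspace, of X p I] unfolding ins by blast
  ultimately have "wedge_map p ` topspace ?S = topspace (wedge X p I)"
    by (rule subset_antisym)
  then show ?thesis
    by (auto simp only: quotient_map_def openin_wedge ins)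
qed

text \<open>All choices of base point on a sphere are equivalent; we take the first unit vector.\<close>

definition wedge_of_spheres :: "nat \<Rightarrow> nat \<Rightarrow> (nat \<times> (nat \<Rightarrow> real)) option topology" where
  "wedge_of_spheres k d = wedge (\<lambda>_. nsphere d) (\<lambda>_ i. if i = 0 then 1 else 0) {..<k}"

end

theory Submission
  imports Defs
begin

text \<open>
  The graph in question is a stack of \<open>m\<close> triangles, a path times a triangle. The proof reduces
  its independence complex by one elementary operation: if the link of a nonempty face is a cone,
  the open star of that face can be deleted. This is a deformation retraction of geometric
  realizations (lemma \<open>homotopy_equivalent_delete_cone_star\<close>), and it leaves the alternating
  sum over the faces unchanged since toggling the apex pairs up the deleted faces. For independence
  complexes, the operation adds or removes an edge, or removes a vertex, under a condition on
  neighbourhoods that is checked on a few vertices.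

  Nine such steps turn the last three triangles into two isolated edges which are no longer
  connected to the rest (lemma \<open>three_end_rows_same_type\<close>). An isolated edge contributes a
  suspension, so three rows amount to a double suspension; a cylinder of two rows
  likewise becomes two isolated edges. Iterating, \<open>p\<close> isolated edges remain if \<open>m\<close> is \<open>0\<close> or \<open>2\<close>
  modulo \<open>3\<close>, and \<open>p\<close> isolated edges and one triangle if \<open>m\<close> is \<open>1\<close> modulo \<open>3\<close>, where \<open>p\<close> is twice
  \<open>(m + 1) div 3\<close>.

  The independence complex of \<open>p\<close> isolated edges is the boundary of a cross-polytope, that is, a
  sphere of dimension \<open>p - 1\<close>. With an additional triangle it is the join of three points with that
  sphere, or three cones with a common base. Doubling the base and applying the same elementary
  operation pulls two of the cones apart until the complex consists of two cross-polytopes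
  with one common vertex (lemma \<open>three_cones_same_type_two_cross_polytopes\<close>), and its realization
  is homeomorphic to a wedge of two spheres of dimension \<open>p\<close>.
\<close>

section \<open>Geometric realizations of finite complexes\<close>

lemma topspace_geometric_realization:
  assumes "finite V" "K \<subseteq> Pow V"
  shows "topspace (geometric_realization K) =
    {x. (\<forall>v. 0 \<le> x v) \<and> {v. x v \<noteq> 0} \<in> K \<and> sum x V = 1}"
proof -
  have "(\<Sum>v | x v \<noteq> 0. x v) = sum x V" if "{v. x v \<noteq> 0} \<in> K" for x :: "'a \<Rightarrow> real"
    using assms that by (intro sum.mono_neutral_left) auto
  then show ?thesis
    by (auto simp: geometric_realization_def)
qed

lemma continuous_map_into_geometric_realization:
  "continuous_map X (geometric_realization K) f \<longleftrightarrow>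
     (\<forall>v. continuous_map X euclideanreal (\<lambda>x. f x v)) \<and>
     f \<in> topspace X \<rightarrow> topspace (geometric_realization K)"
  by (simp add: geometric_realization_def continuous_map_in_subtopology
      continuous_map_componentwise_UNIV)

lemma continuous_map_coordinate:
  "continuous_map (geometric_realization K) euclideanreal (\<lambda>x. x v)"
  unfolding geometric_realization_def
  by (blast intro: continuous_map_from_subtopology [OF continuous_map_product_projection])

lemma continuous_map_Min_coordinate:
  assumes "finite \<tau>" "\<tau> \<noteq> {}"
  shows "continuous_map (geometric_realization K) euclideanreal (\<lambda>x. Min (x ` \<tau>))"
  using assms
  by (induction rule: finite_ne_induct)
    (auto intro: continuous_map_coordinate continuous_map_real_min)

lemma Hausdorff_space_geometric_realization: "Hausdorff_space (geometric_realization K)"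
  unfolding geometric_realization_def
  by (rule Hausdorff_space_subtopology)
    (metis Hausdorff_space_euclidean Hausdorff_space_product_topology)

section \<open>Deleting the star of a face whose link is a cone\<close>

text \<open>
  The faces containing \<open>\<tau>\<close> form the star of \<open>\<tau>\<close>, and \<open>cone\<close> says that its link is a cone with
  apex \<open>w\<close>. On the realization, let \<open>\<mu> x\<close> be the smallest barycentric coordinate of \<open>x\<close> on \<open>\<tau>\<close>;
  it is positive exactly on the open star. Moving weight \<open>\<mu> x\<close> from every vertex of \<open>\<tau>\<close> to \<open>w\<close>
  stays in the complex by the cone condition, makes a coordinate on \<open>\<tau>\<close> vanish and does
  nothing off the open star. Doing so linearly in time is a deformation retraction.
\<close>

lemma homotopy_equivalent_delete_cone_star:
  assumes V: "finite V" "K \<subseteq> Pow V"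
    and down: "\<And>\<rho> \<sigma>. \<sigma> \<in> K \<Longrightarrow> \<rho> \<subseteq> \<sigma> \<Longrightarrow> \<rho> \<in> K"
    and \<tau>: "finite \<tau>" "\<tau> \<noteq> {}" "w \<notin> \<tau>"
    and cone: "\<And>\<sigma>. \<sigma> \<in> K \<Longrightarrow> \<tau> \<subseteq> \<sigma> \<Longrightarrow> insert w \<sigma> \<in> K"
  shows "geometric_realization K homotopy_equivalent_space
    geometric_realization {\<sigma> \<in> K. \<not> \<tau> \<subseteq> \<sigma>}"
proof (rule deformation_retraction_imp_homotopy_equivalent_space)
  let ?X = "geometric_realization K" and ?L = "{\<sigma> \<in> K. \<not> \<tau> \<subseteq> \<sigma>}"
  let ?Y = "geometric_realization ?L"
  define \<mu> where "\<mu> x = Min (x ` \<tau>)" for x :: "'a \<Rightarrow> real"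
  define d :: "'a \<Rightarrow> real" where
    "d v = (if v = w then real (card \<tau>) else if v \<in> \<tau> then - 1 else 0)" for v
  define h where "h s x v = x v + s * \<mu> x * d v" for s and x :: "'a \<Rightarrow> real" and v
  have LV: "?L \<subseteq> Pow V" using V by auto
  note X = topspace_geometric_realization[OF V]
  note Y = topspace_geometric_realization[OF V(1) LV]
  have \<mu>_le: "\<mu> x \<le> x v" if "v \<in> \<tau>" for x v
    using that \<tau> by (simp add: \<mu>_def)
  have \<mu>_attained: "\<exists>v\<in>\<tau>. x v = \<mu> x" for x
  proof -
    have "Min (x ` \<tau>) \<in> x ` \<tau>" using \<tau> by (intro Min_in) auto
    then show ?thesis unfolding \<mu>_def by (metis imageE)
  qed
  have \<mu>_nonneg: "0 \<le> \<mu> x" if "x \<in> topspace ?X" for x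
    using \<mu>_attained[of x] that X by (metis (no_types, lifting) mem_Collect_eq)
  have star: "\<tau> \<subseteq> {v. x v \<noteq> 0}" if "\<mu> x > 0" for x
    using that \<mu>_le[of _ x] by force
  have \<mu>_zero: "\<mu> x = 0" if x: "x \<in> topspace ?Y" for x
  proof -
    obtain v where "v \<in> \<tau>" "x v = 0"
      using x unfolding Y by auto
    moreover have "0 \<le> \<mu> x"
      using x X Y \<mu>_nonneg by auto
    ultimately show ?thesis
      using \<mu>_le[of v x] by simp
  qed
  have h_in: "h s x \<in> topspace ?X" if x: "x \<in> topspace ?X" and s: "s \<in> {0..1}" for s x
  proof (cases "\<mu> x = 0")
    case True
    then have "h s x = x" by (simp add: h_def fun_eq_iff)
    then show ?thesis using x by simp
  next
    case False
    then have pos: "\<mu> x > 0" using \<mu>_nonneg[OF x] by simp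
    have supp: "{v. x v \<noteq> 0} \<in> K" and nonneg: "\<And>v. 0 \<le> x v" and one: "sum x V = 1"
      using x unfolding X by auto
    have ins: "insert w {v. x v \<noteq> 0} \<in> K"
      using cone[OF supp star[OF pos]] .
    then have wV: "w \<in> V" and \<tau>V: "\<tau> \<subseteq> V"
      using V(2) star[OF pos] by blast+
    have "0 \<le> h s x v" for v
    proof -
      have "s * \<mu> x \<le> x v" if "v \<in> \<tau>"
      proof -
        have "s * \<mu> x \<le> 1 * \<mu> x"
          using s pos by (intro mult_right_mono) auto
        also have "\<dots> \<le> x v" using \<mu>_le[OF that] by simp
        finally show ?thesis .
      qed
      then show ?thesis
        using s pos nonneg[of v] by (auto simp: h_def d_def)
    qed
    moreover have "{v. h s x v \<noteq> 0} \<subseteq> insert w {v. x v \<noteq> 0}"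
      using star[OF pos] by (auto simp: h_def d_def split: if_splits)
    then have "{v. h s x v \<noteq> 0} \<in> K"
      using down ins by blast
    moreover have "sum (h s x) V = 1"
    proof -
      have "sum d V = (\<Sum>v\<in>V. (if v = w then real (card \<tau>) else 0) - (if v \<in> \<tau> then 1 else 0))"
        using \<tau> by (intro sum.cong) (auto simp: d_def)
      also have "\<dots> = real (card \<tau>) - real (card (V \<inter> \<tau>))"
        using V wV by (simp add: sum_subtractf sum.If_cases)
      also have "V \<inter> \<tau> = \<tau>" using \<tau>V by auto
      finally have "sum d V = 0" by simp
      then show ?thesis
        using one by (simp add: h_def sum.distrib flip: sum_distrib_left)
    qed
    ultimately show ?thesis
      unfolding X by auto
  qed
  have h1_in: "h 1 x \<in> topspace ?Y" if x: "x \<in> topspace ?X" for x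
  proof -
    obtain v where v: "v \<in> \<tau>" "x v = \<mu> x" using \<mu>_attained by blast
    then have "h 1 x v = 0" using \<tau> by (auto simp: h_def d_def)
    then show ?thesis
      using h_in[OF x, of 1] v unfolding X Y by auto
  qed
  have cont: "continuous_map (prod_topology (top_of_set {0..1}) ?X) ?X (\<lambda>(s, x). h s x)"
    unfolding continuous_map_into_geometric_realization
  proof (intro conjI allI)
    fix v
    have "continuous_map (prod_topology (top_of_set {0..1::real}) ?X) euclideanreal fst"
      by (metis continuous_map_fst continuous_map_into_fulltopology)
    moreover have "continuous_map (prod_topology (top_of_set {0..1::real}) ?X) euclideanreal (\<lambda>z. snd z v)"
      using continuous_map_compose[OF continuous_map_snd continuous_map_coordinate]
      by (force simp: o_def)
    moreover have "continuous_map (prod_topology (top_of_set {0..1::real}) ?X) euclideanreal (\<lambda>z. \<mu> (snd z))"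
      using continuous_map_compose[OF continuous_map_snd continuous_map_Min_coordinate[OF \<tau>(1,2)]]
      by (force simp: o_def \<mu>_def)
    ultimately show "continuous_map (prod_topology (top_of_set {0..1}) ?X) euclideanreal
        (\<lambda>z. (case z of (s, x) \<Rightarrow> h s x) v)"
      unfolding h_def case_prod_unfold by (intro continuous_intros)
  next
    show "(\<lambda>(s, x). h s x) \<in> topspace (prod_topology (top_of_set {0..1}) ?X) \<rightarrow> topspace ?X"
      using h_in by auto
  qed
  have h1_cont: "continuous_map ?X ?Y (h 1)"
    unfolding continuous_map_into_geometric_realization
  proof (intro conjI allI)
    fix v
    show "continuous_map ?X euclideanreal (\<lambda>x. h 1 x v)"
      unfolding h_def \<mu>_def
      by (intro continuous_intros continuous_map_coordinate
          continuous_map_Min_coordinate[OF \<tau>(1,2)])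
  qed (use h1_in in auto)
  have id_cont: "continuous_map ?Y ?X id"
    unfolding continuous_map_into_geometric_realization
    using continuous_map_coordinate X Y by auto
  have "homotopic_with (\<lambda>x. True) ?X ?X id (id \<circ> h 1)"
    unfolding homotopic_with_def
    by (rule exI[of _ "\<lambda>(s, x). h s x"]) (use cont in \<open>auto simp: h_def\<close>)
  then show "homotopic_with (\<lambda>x. True) ?X ?X (id \<circ> h 1) id"
    by (rule homotopic_with_symD)
  show "retraction_maps ?X ?Y (h 1) id"
    unfolding retraction_maps_def
    using h1_cont id_cont \<mu>_zero by (auto simp: h_def)
qed

definition euler_sum :: "'a set set \<Rightarrow> int" where
  "euler_sum K = (\<Sum>\<sigma>\<in>K. (- 1) ^ card \<sigma>)"

text \<open>
  Adding or removing \<open>w\<close> pairs up the faces that contain \<open>\<tau>\<close>, with opposite signs.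
\<close>

lemma euler_sum_delete_cone_star:
  assumes fin: "finite K" "\<And>\<sigma>. \<sigma> \<in> K \<Longrightarrow> finite \<sigma>"
    and down: "\<And>\<rho> \<sigma>. \<sigma> \<in> K \<Longrightarrow> \<rho> \<subseteq> \<sigma> \<Longrightarrow> \<rho> \<in> K"
    and w: "w \<notin> \<tau>"
    and cone: "\<And>\<sigma>. \<sigma> \<in> K \<Longrightarrow> \<tau> \<subseteq> \<sigma> \<Longrightarrow> insert w \<sigma> \<in> K"
  shows "euler_sum {\<sigma> \<in> K. \<not> \<tau> \<subseteq> \<sigma>} = euler_sum K"
proof -
  let ?S = "{\<sigma> \<in> K. \<tau> \<subseteq> \<sigma>}"
  let ?A = "{\<sigma> \<in> ?S. w \<notin> \<sigma>}"
  have inj: "inj_on (insert w) ?A"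
    by (auto intro!: inj_onI)
  have S: "?S = ?A \<union> insert w ` ?A"
  proof (intro equalityI subsetI)
    fix \<sigma> assume \<sigma>: "\<sigma> \<in> ?S"
    show "\<sigma> \<in> ?A \<union> insert w ` ?A"
    proof (cases "w \<in> \<sigma>")
      case True
      then have "\<sigma> = insert w (\<sigma> - {w})" "\<sigma> - {w} \<in> ?A"
        using \<sigma> w down[of \<sigma> "\<sigma> - {w}"] by auto
      then show ?thesis by blast
    qed (use \<sigma> in auto)
  qed (use cone in auto)
  have "(\<Sum>\<sigma>\<in>?S. (- 1 :: int) ^ card \<sigma>) =
      (\<Sum>\<sigma>\<in>?A. (- 1) ^ card \<sigma>) + (\<Sum>\<sigma>\<in>insert w ` ?A. (- 1) ^ card \<sigma>)"
    by (subst S, rule sum.union_disjoint) (use fin in auto)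
  also have "(\<Sum>\<sigma>\<in>insert w ` ?A. (- 1 :: int) ^ card \<sigma>) = (\<Sum>\<sigma>\<in>?A. - ((- 1) ^ card \<sigma>))"
    by (subst sum.reindex[OF inj]) (use fin in \<open>auto intro!: sum.cong\<close>)
  finally have "(\<Sum>\<sigma>\<in>?S. (- 1 :: int) ^ card \<sigma>) = 0"
    by (simp add: sum_negf)
  moreover have "K = {\<sigma> \<in> K. \<not> \<tau> \<subseteq> \<sigma>} \<union> ?S" by auto
  then have "euler_sum K = euler_sum {\<sigma> \<in> K. \<not> \<tau> \<subseteq> \<sigma>} + (\<Sum>\<sigma>\<in>?S. (- 1) ^ card \<sigma>)"
    unfolding euler_sum_def
    by (subst sum.union_disjoint[symmetric]) (use fin in \<open>auto intro: sum.cong\<close>)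
  ultimately show ?thesis by simp
qed

text \<open>
  Both halves of the main result are invariant under the same operations, so they are carried
  along together.
\<close>

definition same_type :: "'a set set \<Rightarrow> 'a set set \<Rightarrow> bool"  (infix "\<simeq>" 50) where
  "K \<simeq> L \<longleftrightarrow> geometric_realization K homotopy_equivalent_space geometric_realization L \<and>
     euler_sum K = euler_sum L"

lemma same_type_refl [simp]: "K \<simeq> K"
  by (simp add: same_type_def homotopy_equivalent_space_refl)

lemma same_type_sym: "K \<simeq> L \<Longrightarrow> L \<simeq> K"
  unfolding same_type_def using homotopy_equivalent_space_sym by metis

lemma same_type_trans [trans]: "K \<simeq> L \<Longrightarrow> L \<simeq> M \<Longrightarrow> K \<simeq> M"
  unfolding same_type_def by (auto intro: homotopy_eqv_trans)

lemma same_type_eq_trans [trans]: "K \<simeq> L \<Longrightarrow> L = M \<Longrightarrow> K \<simeq> M"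
  by simp

lemma eq_same_type_trans [trans]: "K = L \<Longrightarrow> L \<simeq> M \<Longrightarrow> K \<simeq> M"
  by simp

section \<open>Complexes given by forbidden sets\<close>

text \<open>
  Complexes are described by a vertex set and a family of forbidden subsets (non-faces). For the
  independence complex of a graph the forbidden sets are the edges. Deleting a vertex and adding
  an edge then become the same operation, namely forbidding one more set.
\<close>

definition avoiding :: "'a set \<Rightarrow> 'a set set \<Rightarrow> 'a set set" where
  "avoiding V F = {\<sigma>. \<sigma> \<subseteq> V \<and> (\<forall>f\<in>F. \<not> f \<subseteq> \<sigma>)}"

text \<open>
  The condition \<open>cone\<close> translates to forbidden sets that the link of \<open>\<tau>\<close> is a cone with apex \<open>w\<close>: a
  forbidden set that adding \<open>w\<close> to a face above \<open>\<tau>\<close> could complete would leave another forbidden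
  set inside that face. For graphs and \<open>\<tau> = {v}\<close> this is the fold lemma: every neighbour of \<open>w\<close> is
  a neighbour of \<open>v\<close>. For \<open>\<tau> = {u, v}\<close> every neighbour of \<open>w\<close> is a neighbour of \<open>u\<close> or of \<open>v\<close>,
  and the edge \<open>uv\<close> may be added or removed.
\<close>

lemma avoiding_insert_same_type:
  assumes V: "finite V" and w: "w \<in> V" "w \<notin> \<tau>" and \<tau>: "\<tau> \<noteq> {}"
    and cone: "\<And>f. f \<in> F \<Longrightarrow> w \<in> f \<Longrightarrow> \<exists>g\<in>F. g \<subseteq> \<tau> \<union> (f - {w})"
  shows "avoiding V F \<simeq> avoiding V (insert \<tau> F)"
proof (cases "\<tau> \<subseteq> V")
  case True
  let ?K = "avoiding V F"
  have eq: "avoiding V (insert \<tau> F) = {\<sigma> \<in> ?K. \<not> \<tau> \<subseteq> \<sigma>}"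
    by (auto simp: avoiding_def)
  have KV: "?K \<subseteq> Pow V" by (auto simp: avoiding_def)
  have fin: "finite ?K" "\<And>\<sigma>. \<sigma> \<in> ?K \<Longrightarrow> finite \<sigma>" "finite \<tau>"
    using KV V True by (auto intro: finite_subset)
  have down: "\<rho> \<in> ?K" if "\<sigma> \<in> ?K" "\<rho> \<subseteq> \<sigma>" for \<rho> \<sigma>
    using that unfolding avoiding_def by blast
  have "insert w \<sigma> \<in> ?K" if \<sigma>: "\<sigma> \<in> ?K" "\<tau> \<subseteq> \<sigma>" for \<sigma>
  proof -
    have "\<not> f \<subseteq> insert w \<sigma>" if f: "f \<in> F" for f
    proof
      assume sub: "f \<subseteq> insert w \<sigma>"
      show False
      proof (cases "w \<in> f")
        case True
        then obtain g where "g \<in> F" "g \<subseteq> \<tau> \<union> (f - {w})" using cone f by blast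
        then have "g \<subseteq> \<sigma>" using \<sigma>(2) sub by blast
        then show False using \<sigma>(1) \<open>g \<in> F\<close> by (auto simp: avoiding_def)
      qed (use f sub \<sigma> in \<open>auto simp: avoiding_def\<close>)
    qed
    then show ?thesis using \<sigma> w by (auto simp: avoiding_def)
  qed
  then show ?thesis
    unfolding eq same_type_def
    using homotopy_equivalent_delete_cone_star[OF V KV down fin(3) \<tau> w(2)]
      euler_sum_delete_cone_star[OF fin(1,2) down w(2)] by auto
next
  case False
  then have "avoiding V (insert \<tau> F) = avoiding V F"
    by (auto simp: avoiding_def)
  then show ?thesis by simp
qed

text \<open>
  Many sets can be forbidden one after the other: since no set in \<open>T\<close> contains one of the chosen
  apexes, the cone conditions survive the earlier insertions.
\<close>

lemma avoiding_Un_same_type: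
  assumes V: "finite V" and T: "finite T" "{} \<notin> T"
    and cone: "\<And>\<tau>. \<tau> \<in> T \<Longrightarrow> \<exists>w\<in>V. w \<notin> \<Union>T \<and>
       (\<forall>f\<in>F. w \<in> f \<longrightarrow> (\<exists>g\<in>F. g \<subseteq> \<tau> \<union> (f - {w})))"
  shows "avoiding V F \<simeq> avoiding V (F \<union> T)"
proof -
  have "avoiding V F \<simeq> avoiding V (F \<union> S)" if "finite S" "S \<subseteq> T" for S
    using that
  proof (induction S rule: finite_induct)
    case (insert \<tau> S)
    then obtain w where w: "w \<in> V" "w \<notin> \<Union>T"
      and wF: "\<forall>f\<in>F. w \<in> f \<longrightarrow> (\<exists>g\<in>F. g \<subseteq> \<tau> \<union> (f - {w}))"
      using cone[of \<tau>] by (meson insert_subset)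
    have "avoiding V (F \<union> S) \<simeq> avoiding V (insert \<tau> (F \<union> S))"
    proof (rule avoiding_insert_same_type[OF V w(1)])
      show "\<exists>g\<in>F \<union> S. g \<subseteq> \<tau> \<union> (f - {w})" if "f \<in> F \<union> S" "w \<in> f" for f
      proof (cases "f \<in> F")
        case True
        then show ?thesis using wF that(2) by blast
      next
        case False
        then show ?thesis using that w(2) insert.prems by auto
      qed
      show "w \<notin> \<tau>" "\<tau> \<noteq> {}" using w T insert.prems by auto
    qed
    then show ?case
      using insert.IH insert.prems same_type_trans[of "avoiding V F"] by simp
  qed simp
  then show ?thesis using T by blast
qed

section \<open>Cross-polytopes are spheres\<close>

definition antipodal_pairs :: "(nat \<times> bool \<Rightarrow> 'a) \<Rightarrow> nat \<Rightarrow> 'a set set" where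
  "antipodal_pairs e p = {{e (i, True), e (i, False)} |i. i < p}"

text \<open>
  The boundary complex of the \<open>p\<close>-dimensional cross-polytope with vertices \<open>e (i, True)\<close> and
  \<open>e (i, False)\<close> on the two halves of the \<open>i\<close>-th axis; equivalently the independence complex of
  \<open>p\<close> disjoint edges. For \<open>p = 0\<close> it is \<open>{{}}\<close>, whose realization is empty.
\<close>

definition cross_polytope :: "(nat \<times> bool \<Rightarrow> 'a) \<Rightarrow> nat \<Rightarrow> 'a set set" where
  "cross_polytope e p = avoiding (e ` ({..<p} \<times> UNIV)) (antipodal_pairs e p)"

text \<open>
  Radial projection of the Euclidean unit sphere to the unit sphere of the \<open>l\<^sub>1\<close>-norm, read in
  barycentric coordinates: the positive and the negative part of \<open>y i\<close> are the weights of the two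
  vertices on the \<open>i\<close>-th axis.
\<close>

definition sphere_to_cross :: "(nat \<times> bool \<Rightarrow> 'a) \<Rightarrow> nat \<Rightarrow> (nat \<Rightarrow> real) \<Rightarrow> 'a \<Rightarrow> real" where
  "sphere_to_cross e n y v =
     (\<Sum>i\<le>n. (if v = e (i, True) then max (y i) 0 else 0)
           + (if v = e (i, False) then max (- y i) 0 else 0)) / (\<Sum>i\<le>n. \<bar>y i\<bar>)"

lemma sphere_to_cross_vertex:
  assumes "inj_on e ({..n} \<times> UNIV)" "j \<le> n"
  shows "sphere_to_cross e n y (e (j, b)) =
    max (if b then y j else - y j) 0 / (\<Sum>i\<le>n. \<bar>y i\<bar>)"
proof -
  have "e (j, b) = e (i, c) \<longleftrightarrow> j = i \<and> b = c" if "i \<le> n" for i c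
    using inj_onD[OF assms(1), of "(j, b)" "(i, c)"] assms(2) that by auto
  then have "(\<Sum>i\<le>n. (if e (j, b) = e (i, True) then max (y i) 0 else 0)
           + (if e (j, b) = e (i, False) then max (- y i) 0 else 0)) =
     (\<Sum>i\<le>n. if i = j then max (if b then y j else - y j) 0 else 0)"
    by (intro sum.cong) auto
  then show ?thesis
    using assms(2) by (simp add: sphere_to_cross_def)
qed

lemma sphere_to_cross_outside:
  assumes "v \<notin> e ` ({..n} \<times> UNIV)"
  shows "sphere_to_cross e n y v = 0"
proof -
  have "v \<noteq> e (i, c)" if "i \<le> n" for i c
    using assms that by force
  then show ?thesis
    by (simp add: sphere_to_cross_def)
qed

lemma topspace_nsphere:
  "topspace (nsphere n) = {y. (\<Sum>i\<le>n. y i ^ 2) = 1 \<and> (\<forall>i>n. y i = 0)}"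
  by (simp add: nsphere)

lemma nsphere_l1_norm_pos:
  assumes "y \<in> topspace (nsphere n)"
  shows "0 < (\<Sum>i\<le>n. \<bar>y i\<bar>)"
proof -
  have "\<exists>i\<le>n. y i \<noteq> 0"
  proof (rule ccontr)
    assume "\<not> (\<exists>i\<le>n. y i \<noteq> 0)"
    then have "(\<Sum>i\<le>n. y i ^ 2) = 0" by simp
    then show False using assms by (simp add: topspace_nsphere)
  qed
  then show ?thesis
    by (meson abs_ge_zero atMost_iff finite_atMost sum_pos2 zero_less_abs_iff)
qed

lemma sum_cross_vertices:
  fixes x :: "'a \<Rightarrow> real"
  assumes "inj_on e ({..n} \<times> UNIV)"
  shows "sum x (e ` ({..n} \<times> UNIV)) = (\<Sum>i\<le>n. x (e (i, True)) + x (e (i, False)))"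
proof -
  have "sum x (e ` ({..n} \<times> UNIV)) = (\<Sum>z\<in>{..n} \<times> UNIV. x (e z))"
    using assms by (simp add: sum.reindex o_def)
  also have "\<dots> = (\<Sum>i\<le>n. \<Sum>b\<in>UNIV. x (e (i, b)))"
    by (simp add: sum.cartesian_product)
  finally show ?thesis
    by (simp add: UNIV_bool add.commute)
qed

lemma cross_polytope_Suc:
  "cross_polytope e (Suc n) =
    {\<sigma>. \<sigma> \<subseteq> e ` ({..n} \<times> UNIV) \<and> (\<forall>i\<le>n. e (i, True) \<notin> \<sigma> \<or> e (i, False) \<notin> \<sigma>)}"
  by (auto simp: cross_polytope_def antipodal_pairs_def avoiding_def lessThan_Suc_atMost less_Suc_eq_le)

lemma cross_polytope_subset: "cross_polytope e p \<subseteq> Pow (e ` ({..<p} \<times> UNIV))"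
  by (auto simp: cross_polytope_def antipodal_pairs_def avoiding_def)

lemma topspace_cross_polytope:
  assumes "inj_on e ({..n} \<times> UNIV)"
  shows "topspace (geometric_realization (cross_polytope e (Suc n))) =
    {x. (\<forall>v. 0 \<le> x v) \<and> (\<forall>v. v \<notin> e ` ({..n} \<times> UNIV) \<longrightarrow> x v = 0) \<and>
        (\<forall>i\<le>n. x (e (i, True)) = 0 \<or> x (e (i, False)) = 0) \<and>
        (\<Sum>i\<le>n. x (e (i, True)) + x (e (i, False))) = 1}"
  using cross_polytope_subset[of e "Suc n"]
  by (subst topspace_geometric_realization[of "e ` ({..n} \<times> UNIV)"])
    (auto simp: lessThan_Suc_atMost sum_cross_vertices[OF assms] cross_polytope_Suc)

lemma sphere_to_cross_in:
  assumes inj: "inj_on e ({..n} \<times> UNIV)" and y: "y \<in> topspace (nsphere n)"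
  shows "sphere_to_cross e n y \<in> topspace (geometric_realization (cross_polytope e (Suc n)))"
proof -
  note pos = nsphere_l1_norm_pos[OF y]
  note vertex = sphere_to_cross_vertex[OF inj]
  have "0 \<le> sphere_to_cross e n y v" for v
    unfolding sphere_to_cross_def
    by (intro divide_nonneg_nonneg sum_nonneg) auto
  moreover have "(\<Sum>i\<le>n. sphere_to_cross e n y (e (i, True)) + sphere_to_cross e n y (e (i, False)))
      = (\<Sum>i\<le>n. \<bar>y i\<bar> / (\<Sum>i\<le>n. \<bar>y i\<bar>))"
    by (intro sum.cong) (auto simp: vertex simp flip: add_divide_distrib)
  then have "(\<Sum>i\<le>n. sphere_to_cross e n y (e (i, True)) + sphere_to_cross e n y (e (i, False))) = 1"
    using pos by (simp flip: sum_divide_distrib)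
  moreover have "sphere_to_cross e n y (e (i, True)) = 0 \<or> sphere_to_cross e n y (e (i, False)) = 0"
    if "i \<le> n" for i
    using that by (auto simp: vertex)
  ultimately show ?thesis
    unfolding topspace_cross_polytope[OF inj] by (auto simp: sphere_to_cross_outside)
qed

text \<open>
  The inverse is radial projection back: \<open>z\<close> is the point with coordinates \<open>x\<close> in the
  cross-polytope, and \<open>L\<close> its Euclidean norm.
\<close>

lemma sphere_to_cross_surj:
  assumes inj: "inj_on e ({..n} \<times> UNIV)"
    and x: "x \<in> topspace (geometric_realization (cross_polytope e (Suc n)))"
  obtains y where "y \<in> topspace (nsphere n)" "sphere_to_cross e n y = x"
proof -
  define z where "z i = (if i \<le> n then x (e (i, True)) - x (e (i, False)) else 0)" for i
  define L where "L = sqrt (\<Sum>i\<le>n. z i ^ 2)"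
  note X = x[unfolded topspace_cross_polytope[OF inj], simplified]
  have abs_z: "\<bar>z i\<bar> = x (e (i, True)) + x (e (i, False))" if "i \<le> n" for i
  proof -
    have "x (e (i, True)) = 0 \<or> x (e (i, False)) = 0" "0 \<le> x (e (i, True))" "0 \<le> x (e (i, False))"
      using X that by auto
    then show ?thesis using that by (auto simp: z_def)
  qed
  then have sum_z: "(\<Sum>i\<le>n. \<bar>z i\<bar>) = 1"
    using X by simp
  have "\<not> (\<forall>i\<le>n. z i = 0)"
  proof
    assume "\<forall>i\<le>n. z i = 0"
    then have "(\<Sum>i\<le>n. \<bar>z i\<bar>) = 0" by simp
    then show False using sum_z by simp
  qed
  then have "0 < (\<Sum>i\<le>n. z i ^ 2)"
    by (meson atMost_iff finite_atMost sum_pos2 zero_le_power2 zero_less_power2)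
  then have L: "L > 0" "L ^ 2 = (\<Sum>i\<le>n. z i ^ 2)"
    by (auto simp: L_def)
  define y where "y i = z i / L" for i
  have "y \<in> topspace (nsphere n)"
  proof -
    have "(\<Sum>i\<le>n. y i ^ 2) = (\<Sum>i\<le>n. z i ^ 2) / L ^ 2"
      by (simp add: y_def power_divide flip: sum_divide_distrib)
    also have "\<dots> = 1"
      using L by (metis divide_self_if less_irrefl power_not_zero)
    finally show ?thesis
      by (simp add: topspace_nsphere y_def z_def)
  qed
  moreover have "sphere_to_cross e n y v = x v" for v
  proof (cases "v \<in> e ` ({..n} \<times> UNIV)")
    case True
    then obtain i b where i: "i \<le> n" "v = e (i, b)" by auto
    have "(\<Sum>i\<le>n. \<bar>y i\<bar>) = 1 / L"
      using sum_z L by (simp add: y_def flip: sum_divide_distrib)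
    then have "sphere_to_cross e n y v = max (if b then z i / L else - (z i / L)) 0 * L"
      using i sphere_to_cross_vertex[OF inj, of i y b] by (simp add: y_def)
    also have "\<dots> = max (if b then z i else - z i) 0"
      using L by (auto simp: max_def field_simps zero_le_divide_iff)
    also have "\<dots> = x v"
    proof -
      have "x (e (i, True)) = 0 \<or> x (e (i, False)) = 0" "0 \<le> x (e (i, True))" "0 \<le> x (e (i, False))"
        using X i by auto
      then show ?thesis using i by (cases b) (auto simp: z_def)
    qed
    finally show ?thesis .
  qed (use X in \<open>auto simp: sphere_to_cross_outside\<close>)
  ultimately show thesis
    using that by blast
qed

text \<open>
  Points with the same image lie on the same ray from the origin, and a ray meets the sphere only
  once.
\<close>

lemma sphere_to_cross_inj:
  assumes inj: "inj_on e ({..n} \<times> UNIV)"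
    and y: "y \<in> topspace (nsphere n)" and z: "z \<in> topspace (nsphere n)"
    and eq: "sphere_to_cross e n y = sphere_to_cross e n z"
  shows "y = z"
proof -
  define N where "N y = (\<Sum>i\<le>n. \<bar>y i\<bar>)" for y :: "nat \<Rightarrow> real"
  have N: "N y > 0" "N z > 0"
    using nsphere_l1_norm_pos y z by (auto simp: N_def)
  have diff: "sphere_to_cross e n u (e (i, True)) - sphere_to_cross e n u (e (i, False)) = u i / N u"
    if "i \<le> n" for u i
    using that by (simp add: sphere_to_cross_vertex[OF inj] N_def max_def field_simps)
  have ray: "y i / N y = z i / N z" if "i \<le> n" for i
    using diff[OF that, of y] diff[OF that, of z] eq by simp
  have one: "(\<Sum>i\<le>n. (u i / N u)\<^sup>2) = 1 / (N u)\<^sup>2" if "u \<in> topspace (nsphere n)" for u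
    using that by (simp add: topspace_nsphere power_divide flip: sum_divide_distrib)
  have "1 / (N y)\<^sup>2 = 1 / (N z)\<^sup>2"
    unfolding one[OF y, symmetric] one[OF z, symmetric] by (intro sum.cong) (auto simp: ray)
  then have "N y = N z"
    using N by (simp add: power2_eq_iff_nonneg)
  then have "y i = z i" if "i \<le> n" for i
    using ray[OF that] N by simp
  moreover have "y i = z i" if "\<not> i \<le> n" for i
    using that y z by (simp add: topspace_nsphere)
  ultimately show ?thesis by blast
qed

lemma continuous_sphere_to_cross:
  "continuous_map (nsphere n) euclideanreal (\<lambda>y. sphere_to_cross e n y v)"
proof -
  have "continuous_map (nsphere n) euclideanreal (\<lambda>y. if P then max (u y) 0 else 0)"
    if "continuous_map (nsphere n) euclideanreal u" for P and u :: "_ \<Rightarrow> real"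
    by (cases P) (auto intro!: continuous_intros that)
  moreover have "continuous_map (nsphere n) euclideanreal (\<lambda>y. \<bar>y i\<bar>)" for i
    using continuous_map_real_abs[OF continuous_map_nsphere_projection] .
  ultimately show ?thesis
    unfolding sphere_to_cross_def
    by (intro continuous_intros) (auto intro: continuous_map_nsphere_projection continuous_intros
        simp: less_imp_neq[OF nsphere_l1_norm_pos, symmetric])
qed

text \<open>
  The sphere is closed in a product of compact intervals.
\<close>

lemma compact_space_nsphere: "compact_space (nsphere n)"
proof -
  define C where "C = (\<Pi>\<^sub>E i\<in>UNIV. if i \<le> n then {-1..1} else {0 :: real})"
  let ?P = "powertop_real (UNIV :: nat set)"
  have C: "compactin ?P C"
    unfolding C_def compactin_PiE by auto
  have "closedin ?P {y \<in> topspace ?P. (\<Sum>i\<le>n. y i ^ 2) \<in> {1}}"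
    by (rule closedin_continuous_map_preimage[where Y = euclideanreal])
      (auto intro!: continuous_intros continuous_map_product_projection)
  then have "compactin ?P (C \<inter> {y. (\<Sum>i\<le>n. y i ^ 2) = 1})"
    using C by (simp add: compact_Int_closedin)
  moreover have "C \<inter> {y. (\<Sum>i\<le>n. y i ^ 2) = 1} = {y. (\<Sum>i\<le>n. y i ^ 2) = 1 \<and> (\<forall>i>n. y i = 0)}"
  proof -
    have "\<bar>y i\<bar> \<le> 1" if "(\<Sum>i\<le>n. y i ^ 2) = 1" "i \<le> n" for y :: "nat \<Rightarrow> real" and i
    proof -
      have "y i ^ 2 \<le> 1"
        using that member_le_sum[of i "{..n}" "\<lambda>i. y i ^ 2"] by simp
      then show ?thesis by (simp add: abs_square_le_1)
    qed
    then show ?thesis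
      by (force simp: C_def PiE_UNIV_domain abs_le_iff split: if_splits)
  qed
  ultimately show ?thesis
    unfolding nsphere by (simp add: compact_space_subtopology)
qed

lemma cross_polytope_homeomorphic_nsphere:
  assumes inj: "inj_on e ({..n} \<times> UNIV)"
  shows "geometric_realization (cross_polytope e (Suc n)) homeomorphic_space nsphere n"
proof -
  let ?X = "geometric_realization (cross_polytope e (Suc n))"
  have "homeomorphic_map (nsphere n) ?X (sphere_to_cross e n)"
  proof (rule continuous_imp_homeomorphic_map)
    show "continuous_map (nsphere n) ?X (sphere_to_cross e n)"
      unfolding continuous_map_into_geometric_realization
      using continuous_sphere_to_cross sphere_to_cross_in[OF inj] by auto
    show "sphere_to_cross e n ` topspace (nsphere n) = topspace ?X"
      using sphere_to_cross_in[OF inj] sphere_to_cross_surj[OF inj] by (metis (no_types, opaque_lifting) image_iff subsetI subset_antisym)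
    show "inj_on (sphere_to_cross e n) (topspace (nsphere n))"
      using sphere_to_cross_inj[OF inj] by (auto intro: inj_onI)
  qed (auto simp: compact_space_nsphere Hausdorff_space_geometric_realization)
  then show ?thesis
    using homeomorphic_map_imp_homeomorphic_space homeomorphic_space_sym by blast
qed

section \<open>Wedges of spheres as unions of two cross-polytopes\<close>

lemma compact_space_sum_topology:
  assumes "finite I" "\<And>i. i \<in> I \<Longrightarrow> compact_space (X i)"
  shows "compact_space (sum_topology X I)"
proof -
  have "compactin (sum_topology X I) (Pair i ` topspace (X i))" if "i \<in> I" for i
    using assms(2)[OF that] continuous_map_component_injection[OF that]
    by (auto simp: compact_space_def intro: image_compactin)
  then have "compactin (sum_topology X I) (\<Union>i\<in>I. Pair i ` topspace (X i))"
    using assms(1) by (intro compactin_Union) auto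
  moreover have "(\<Union>i\<in>I. Pair i ` topspace (X i)) = topspace (sum_topology X I)"
    by auto
  ultimately show ?thesis
    by (simp add: compact_space_def)
qed

text \<open>
  The base point of the sphere is sent to the vertex \<open>e (0, True)\<close>, which will serve as the common
  vertex of two cross-polytopes.
\<close>

lemma sphere_to_cross_base:
  assumes "inj_on e ({..n} \<times> UNIV)"
  shows "sphere_to_cross e n (\<lambda>i. if i = 0 then 1 else 0) = (\<lambda>v. if v = e (0, True) then 1 else 0)"
proof
  fix v
  have one: "(\<Sum>i\<le>n. \<bar>if i = 0 then 1 else 0 :: real\<bar>) = 1"
    by (simp add: if_distrib[of abs] cong: if_cong)
  show "sphere_to_cross e n (\<lambda>i. if i = 0 then 1 else 0) v = (if v = e (0, True) then 1 else 0)"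
  proof (cases "v \<in> e ` ({..n} \<times> UNIV)")
    case True
    then obtain i b where i: "i \<le> n" "v = e (i, b)" by auto
    then have "v = e (0, True) \<longleftrightarrow> i = 0 \<and> b"
      using inj_onD[OF assms, of "(i, b)" "(0, True)"] by auto
    then show ?thesis
      using i by (simp add: sphere_to_cross_vertex[OF assms] one)
  qed (force simp: sphere_to_cross_outside)
qed

text \<open>
  The maps \<open>sphere_to_cross (e 0)\<close> and \<open>sphere_to_cross (e 1)\<close> agree at the base points and hence
  induce a map \<open>\<phi>\<close> on the wedge. It is a continuous bijection from a compact space to a Hausdorff
  space. Injectivity across the two spheres holds because a point supported on both
  cross-polytopes has only the coordinate at \<open>c\<close>.
\<close>

lemma two_cross_polytopes_homeomorphic_wedge:
  assumes inj: "\<And>k. k < 2 \<Longrightarrow> inj_on (e k) ({..n} \<times> UNIV)"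
    and base: "\<And>k. k < 2 \<Longrightarrow> e k (0, True) = c"
    and meet: "e 0 ` ({..n} \<times> UNIV) \<inter> e (1::nat) ` ({..n} \<times> UNIV) \<subseteq> {c}"
  shows "geometric_realization (cross_polytope (e 0) (Suc n) \<union> cross_polytope (e 1) (Suc n))
    homeomorphic_space wedge_of_spheres 2 n"
proof -
  let ?K = "cross_polytope (e 0) (Suc n) \<union> cross_polytope (e 1) (Suc n)"
  let ?X = "geometric_realization ?K"
  let ?V = "\<lambda>k. e k ` ({..n} \<times> UNIV)"
  let ?b = "\<lambda>i. if i = 0 then 1 else 0 :: real"
  let ?S = "sum_topology (\<lambda>_. nsphere n) {..<2::nat}"
  define \<phi> where "\<phi> w = (case w of None \<Rightarrow> (\<lambda>v. if v = c then 1 else 0)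
     | Some (k, y) \<Rightarrow> sphere_to_cross (e k) n y)" for w
  have two: "k = 0 \<or> k = 1" if "k < 2" for k :: nat using that by auto
  have q: "quotient_map ?S (wedge_of_spheres 2 n) (wedge_map (\<lambda>_. ?b))"
    unfolding wedge_of_spheres_def
    by (rule quotient_map_wedge) (auto simp: in_topspace_nsphere lessThan_empty_iff)
  have \<phi>_wedge: "\<phi> (wedge_map (\<lambda>_. ?b) (k, y)) = sphere_to_cross (e k) n y" if "k < 2" for k y
    using sphere_to_cross_base[OF inj[OF that]] base[OF that]
    by (auto simp: \<phi>_def wedge_map_def)
  have VK: "?K \<subseteq> Pow (?V 0 \<union> ?V 1)"
    using cross_polytope_subset[of "e 0" "Suc n"] cross_polytope_subset[of "e 1" "Suc n"]
    by (auto simp: lessThan_Suc_atMost)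
  have "finite (?V 0 \<union> ?V 1)" by simp
  note X = topspace_geometric_realization[OF this VK]
  have topX: "topspace ?X = (\<Union>k<2. topspace (geometric_realization (cross_polytope (e k) (Suc n))))"
    by (auto simp: geometric_realization_def numeral_2_eq_2 lessThan_Suc)
  have S_in: "sphere_to_cross (e k) n y \<in> topspace ?X"
    if "k < 2" "y \<in> topspace (nsphere n)" for k y
    unfolding topX using sphere_to_cross_in[OF inj[OF that(1)] that(2)] that(1) by blast
  have top_wedge: "topspace (wedge_of_spheres 2 n) =
      wedge_map (\<lambda>_. ?b) ` ({..<2} \<times> topspace (nsphere n))"
    using quotient_imp_surjective_map[OF q] by simp
  have "homeomorphic_map (wedge_of_spheres 2 n) ?X \<phi>"
  proof (rule continuous_imp_homeomorphic_map)
    show "compact_space (wedge_of_spheres 2 n)"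
      using compact_space_sum_topology[of "{..<2::nat}" "\<lambda>_. nsphere n"] compact_space_nsphere q
      by (metis compact_space_def finite_lessThan image_compactin quotient_imp_continuous_map
          quotient_imp_surjective_map)
    show "Hausdorff_space ?X" by (rule Hausdorff_space_geometric_realization)
    have "continuous_map ?S ?X (\<phi> \<circ> wedge_map (\<lambda>_. ?b))"
      unfolding continuous_map_into_geometric_realization
    proof (intro conjI allI)
      fix v
      have "openin (nsphere n) {y \<in> topspace (nsphere n). sphere_to_cross (e k) n y v \<in> U}"
        if "open U" for k U
        using continuous_sphere_to_cross[of n "e k" v] that by (auto simp: continuous_map)
      then have "continuous_map ?S euclideanreal (\<lambda>z. sphere_to_cross (e (fst z)) n (snd z) v)"
        by (auto simp: continuous_map openin_sum_topology)
      then show "continuous_map ?S euclideanreal (\<lambda>z. (\<phi> \<circ> wedge_map (\<lambda>_. ?b)) z v)"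
        by (rule continuous_map_eq) (auto simp: \<phi>_wedge)
    next
      show "\<phi> \<circ> wedge_map (\<lambda>_. ?b) \<in> topspace ?S \<rightarrow> topspace ?X"
        using S_in by (auto simp: \<phi>_wedge simp del: One_nat_def)
    qed
    then show "continuous_map (wedge_of_spheres 2 n) ?X \<phi>"
      using continuous_compose_quotient_map_eq[OF q] by blast
    show "\<phi> ` topspace (wedge_of_spheres 2 n) = topspace ?X"
    proof -
      have "sphere_to_cross (e k) n ` topspace (nsphere n) =
          topspace (geometric_realization (cross_polytope (e k) (Suc n)))" if "k < 2" for k
        using sphere_to_cross_in[OF inj[OF that]] sphere_to_cross_surj[OF inj[OF that]]
        by (metis (no_types, opaque_lifting) image_iff subsetI subset_antisym)
      then have "(\<Union>k<2. sphere_to_cross (e k) n ` topspace (nsphere n)) = topspace ?X"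
        unfolding topX by auto
      moreover have "\<phi> ` topspace (wedge_of_spheres 2 n) =
          (\<Union>k<2. sphere_to_cross (e k) n ` topspace (nsphere n))"
        unfolding top_wedge by (force simp: \<phi>_wedge image_iff)
      ultimately show ?thesis by simp
    qed
    show "inj_on \<phi> (topspace (wedge_of_spheres 2 n))"
    proof -
      have same: "wedge_map (\<lambda>_. ?b) (k, y) = wedge_map (\<lambda>_. ?b) (l, z)"
        if kl: "k < 2" "l < 2" and yz: "y \<in> topspace (nsphere n)" "z \<in> topspace (nsphere n)"
          and eq: "sphere_to_cross (e k) n y = sphere_to_cross (e l) n z" for k l y z
      proof (cases "k = l")
        case True
        then show ?thesis using sphere_to_cross_inj[OF inj[OF kl(1)] yz] eq by simp
      next
        case False
        let ?x = "sphere_to_cross (e k) n y"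
        have "?V k \<inter> ?V l \<subseteq> {c}"
          using False two[OF kl(1)] two[OF kl(2)] meet by auto
        then have off: "?x v = 0" if "v \<noteq> c" for v
          using that sphere_to_cross_outside[of v "e k" n y] sphere_to_cross_outside[of v "e l" n z] eq
          by (metis (no_types, lifting) IntI singletonD subsetD)
        have "?x \<in> topspace ?X"
          using S_in kl yz by blast
        then have "sum ?x (?V 0 \<union> ?V 1) = 1"
          unfolding X by simp
        moreover have "sum ?x (?V 0 \<union> ?V 1) = sum ?x {c}"
        proof (rule sum.mono_neutral_right)
          show "{c} \<subseteq> ?V 0 \<union> ?V 1" using base[of 0] by force
        qed (use off in auto)
        ultimately have "?x c = 1" by simp
        then have "?x = (\<lambda>v. if v = c then 1 else 0)"
          using off by auto
        then have "sphere_to_cross (e k) n y = sphere_to_cross (e k) n ?b"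
          "sphere_to_cross (e l) n z = sphere_to_cross (e l) n ?b"
          using eq sphere_to_cross_base[OF inj] base kl by simp_all
        then have "y = ?b" "z = ?b"
          using sphere_to_cross_inj[OF inj[OF kl(1)] yz(1) in_topspace_nsphere]
            sphere_to_cross_inj[OF inj[OF kl(2)] yz(2) in_topspace_nsphere] by blast+
        then show ?thesis by (simp add: wedge_map_def)
      qed
      show ?thesis
        unfolding top_wedge
      proof (rule inj_onI)
        fix u w
        assume "u \<in> wedge_map (\<lambda>_. ?b) ` ({..<2} \<times> topspace (nsphere n))"
          and "w \<in> wedge_map (\<lambda>_. ?b) ` ({..<2} \<times> topspace (nsphere n))"
          and eq: "\<phi> u = \<phi> w"
        then obtain k y l z where kl: "k < 2" "l < 2"
          and yz: "y \<in> topspace (nsphere n)" "z \<in> topspace (nsphere n)"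
          and uw: "u = wedge_map (\<lambda>_. ?b) (k, y)" "w = wedge_map (\<lambda>_. ?b) (l, z)"
          by blast
        show "u = w"
          using same[OF kl yz] eq unfolding uw \<phi>_wedge[OF kl(1)] \<phi>_wedge[OF kl(2)] .
      qed
    qed
  qed
  then show ?thesis
    using homeomorphic_map_imp_homeomorphic_space homeomorphic_space_sym by blast
qed

section \<open>Euler sums of joins with finitely many points\<close>

text \<open>
  The complex is the join of \<open>K\<close> with a discrete set \<open>A\<close>, and each point of \<open>A\<close> contributes one copy
  of \<open>K\<close> in which every face has gained a vertex.
\<close>

lemma euler_sum_join_points:
  assumes K: "finite K" "\<And>\<sigma>. \<sigma> \<in> K \<Longrightarrow> finite \<sigma>"
    and A: "finite A" "A \<inter> \<Union>K = {}"
  shows "euler_sum (K \<union> (\<Union>a\<in>A. insert a ` K)) = (1 - int (card A)) * euler_sum K"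
  using A
proof (induction A rule: finite_induct)
  case (insert a A)
  let ?L = "K \<union> (\<Union>a\<in>A. insert a ` K)"
  have inj: "inj_on (insert a) K"
    using insert.prems by (intro inj_onI) (metis Diff_insert_absorb IntI UnionI empty_iff insertI1)
  have new: "a \<notin> \<Union>?L"
    using insert.prems insert.hyps by auto
  have "euler_sum (insert a ` K) = (\<Sum>\<sigma>\<in>K. (- 1) ^ card (insert a \<sigma>))"
    unfolding euler_sum_def by (simp add: sum.reindex[OF inj])
  also have "\<dots> = (\<Sum>\<sigma>\<in>K. - ((- 1) ^ card \<sigma>))"
    using K new by (intro sum.cong) auto
  finally have "euler_sum (insert a ` K) = - euler_sum K"
    by (simp add: euler_sum_def sum_negf)
  moreover have "K \<union> (\<Union>a\<in>insert a A. insert a ` K) = ?L \<union> insert a ` K"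
    by auto
  moreover have "?L \<inter> insert a ` K = {}"
    using new by blast
  then have "euler_sum (?L \<union> insert a ` K) = euler_sum ?L + euler_sum (insert a ` K)"
    unfolding euler_sum_def using K(1) insert.hyps by (intro sum.union_disjoint) auto
  ultimately show ?case
    using insert by (simp add: algebra_simps)
qed simp

text \<open>
  Forbidding all pairs in \<open>A\<close> makes \<open>A\<close> a discrete set of points, joined to a complex on \<open>V\<close>.
\<close>

lemma euler_sum_avoiding_join_points:
  assumes fin: "finite A" "finite V" and disj: "A \<inter> V = {}" and F: "\<And>f. f \<in> F \<Longrightarrow> f \<subseteq> V"
  shows "euler_sum (avoiding (A \<union> V) ({{a, b} |a b. a \<in> A \<and> b \<in> A \<and> a \<noteq> b} \<union> F)) =
    (1 - int (card A)) * euler_sum (avoiding V F)"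
proof -
  let ?P = "{{a, b} |a b. a \<in> A \<and> b \<in> A \<and> a \<noteq> b}" and ?K = "avoiding V F"
  have "avoiding (A \<union> V) (?P \<union> F) = ?K \<union> (\<Union>a\<in>A. insert a ` ?K)"
  proof (intro equalityI subsetI)
    fix \<sigma> assume \<sigma>: "\<sigma> \<in> avoiding (A \<union> V) (?P \<union> F)"
    then have sub: "\<sigma> \<subseteq> A \<union> V" and avoid: "\<And>f. f \<in> ?P \<union> F \<Longrightarrow> \<not> f \<subseteq> \<sigma>"
      by (auto simp: avoiding_def)
    have rest: "\<sigma> \<inter> V \<in> ?K"
      using avoid by (auto simp: avoiding_def)
    have single: "a = b" if "a \<in> \<sigma> \<inter> A" "b \<in> \<sigma> \<inter> A" for a b
      using avoid[of "{a, b}"] that by blast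
    show "\<sigma> \<in> ?K \<union> (\<Union>a\<in>A. insert a ` ?K)"
    proof (cases "\<sigma> \<inter> A = {}")
      case True
      then have "\<sigma> = \<sigma> \<inter> V" using sub by blast
      then show ?thesis using rest by simp
    next
      case False
      then obtain a where "a \<in> \<sigma> \<inter> A" by blast
      then have "\<sigma> = insert a (\<sigma> \<inter> V)" "a \<in> A" using single sub by blast+
      then show ?thesis using rest by blast
    qed
  next
    fix \<sigma> assume "\<sigma> \<in> ?K \<union> (\<Union>a\<in>A. insert a ` ?K)"
    then obtain \<rho> where \<rho>: "\<rho> \<in> ?K" "\<sigma> = \<rho> \<or> (\<exists>a\<in>A. \<sigma> = insert a \<rho>)" by blast
    then have "\<rho> \<subseteq> V" by (simp add: avoiding_def)
    then have "\<rho> = \<sigma> \<inter> V" "\<sigma> \<subseteq> A \<union> V" and single: "\<And>a b. a \<in> \<sigma> \<inter> A \<Longrightarrow> b \<in> \<sigma> \<inter> A \<Longrightarrow> a = b"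
      using \<rho>(2) disj by auto
    moreover have "\<not> f \<subseteq> \<sigma>" if "f \<in> ?P" for f
      using that single by blast
    moreover have "\<not> f \<subseteq> \<sigma>" if "f \<in> F" for f
      using that F[OF that] \<rho>(1) \<open>\<rho> = \<sigma> \<inter> V\<close> by (auto simp: avoiding_def)
    ultimately show "\<sigma> \<in> avoiding (A \<union> V) (?P \<union> F)"
      by (auto simp: avoiding_def)
  qed
  moreover have "finite ?K" "\<And>\<sigma>. \<sigma> \<in> ?K \<Longrightarrow> finite \<sigma>"
    using fin(2) by (auto simp: avoiding_def intro: finite_subset)
  moreover have "A \<inter> \<Union>?K = {}"
    using disj by (auto simp: avoiding_def)
  ultimately show ?thesis
    using euler_sum_join_points[of ?K A] fin(1) by simp
qed

lemma euler_sum_cross_polytope: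
  assumes "inj_on e ({..<p} \<times> UNIV)"
  shows "euler_sum (cross_polytope e p) = (- 1) ^ p"
  using assms
proof (induction p)
  case 0
  have "cross_polytope e 0 = {{}}"
    by (auto simp: cross_polytope_def antipodal_pairs_def avoiding_def)
  then show ?case by (simp add: euler_sum_def)
next
  case (Suc p)
  let ?V = "e ` ({..<p} \<times> UNIV)" and ?A = "{e (p, True), e (p, False)}"
  have inj: "inj_on e ({..<p} \<times> UNIV)"
    by (rule inj_on_subset[OF Suc.prems]) auto
  have "e (p, b) \<noteq> e (i, c)" if "i < p" for b i c
    using inj_onD[OF Suc.prems, of "(p, b)" "(i, c)"] that by auto
  then have disj: "?A \<inter> ?V = {}"
    by blast
  have ne: "e (p, True) \<noteq> e (p, False)"
    using inj_onD[OF Suc.prems, of "(p, True)" "(p, False)"] by auto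
  have V: "e ` ({..<Suc p} \<times> UNIV) = ?A \<union> ?V"
    by (auto simp: lessThan_Suc UNIV_bool)
  have F: "antipodal_pairs e (Suc p) =
      {{a, b} |a b. a \<in> ?A \<and> b \<in> ?A \<and> a \<noteq> b} \<union> antipodal_pairs e p"
  proof -
    have "antipodal_pairs e (Suc p) = insert ?A (antipodal_pairs e p)"
      by (auto simp: antipodal_pairs_def less_Suc_eq)
    moreover have "{{a, b} |a b. a \<in> ?A \<and> b \<in> ?A \<and> a \<noteq> b} = {?A}"
      using ne by auto
    ultimately show ?thesis by simp
  qed
  have "euler_sum (cross_polytope e (Suc p)) = (1 - int (card ?A)) * euler_sum (cross_polytope e p)"
    unfolding cross_polytope_def V F
    by (rule euler_sum_avoiding_join_points) (use disj in \<open>auto simp: antipodal_pairs_def\<close>)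
  then show ?case
    using ne Suc.IH[OF inj] by simp
qed

section \<open>Three cones over a sphere\<close>

lemma infinite_fresh_injection:
  assumes "infinite (UNIV :: 'a set)" "finite (S :: 'a set)" "countable (UNIV :: 'i set)"
  obtains e :: "'i \<Rightarrow> 'a" where "inj e" "range e \<inter> S = {}"
proof -
  obtain g :: "nat \<Rightarrow> 'a" where g: "inj g" "range g \<subseteq> - S"
    using infinite_countable_subset[of "- S"] assms(1,2) by (metis finite_Diff2 Compl_eq_Diff_UNIV)
  obtain h :: "'i \<Rightarrow> nat" where h: "inj h"
    using assms(3) unfolding countable_def by blast
  show thesis
    using that[of "g \<circ> h"] g h by (auto simp: inj_compose)
qed

text \<open>
  The join of a cross-polytope with two points \<open>c\<close> and \<open>a\<close> is a cross-polytope again; the new axis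
  is put at index \<open>0\<close>, so that \<open>c\<close> is the vertex to which the base point of the sphere is sent.
\<close>

definition suspension_vertices :: "'a \<Rightarrow> 'a \<Rightarrow> (nat \<times> bool \<Rightarrow> 'a) \<Rightarrow> nat \<times> bool \<Rightarrow> 'a" where
  "suspension_vertices c a e =
     (\<lambda>(i, s). case i of 0 \<Rightarrow> (if s then c else a) | Suc j \<Rightarrow> e (j, s))"

lemma image_suspension_vertices:
  "suspension_vertices c a e ` ({..n} \<times> UNIV) = {c, a} \<union> e ` ({..<n} \<times> UNIV)"
proof (intro equalityI subsetI)
  fix v assume "v \<in> suspension_vertices c a e ` ({..n} \<times> UNIV)"
  then obtain i s where "i \<le> n" "v = suspension_vertices c a e (i, s)" by auto
  then show "v \<in> {c, a} \<union> e ` ({..<n} \<times> UNIV)"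
    by (cases i) (auto simp: suspension_vertices_def)
next
  fix v assume "v \<in> {c, a} \<union> e ` ({..<n} \<times> UNIV)"
  then consider "v = c" | "v = a" | j s where "j < n" "v = e (j, s)" by auto
  then show "v \<in> suspension_vertices c a e ` ({..n} \<times> UNIV)"
  proof cases
    case 1
    then show ?thesis by (intro image_eqI[of _ _ "(0, True)"]) (auto simp: suspension_vertices_def)
  next
    case 2
    then show ?thesis by (intro image_eqI[of _ _ "(0, False)"]) (auto simp: suspension_vertices_def)
  next
    case (3 j s)
    then show ?thesis by (intro image_eqI[of _ _ "(Suc j, s)"]) (auto simp: suspension_vertices_def)
  qed
qed

lemma inj_suspension_vertices:
  assumes "inj_on e ({..<n} \<times> UNIV)" "c \<noteq> a" "{c, a} \<inter> e ` ({..<n} \<times> UNIV) = {}"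
  shows "inj_on (suspension_vertices c a e) ({..n} \<times> UNIV)"
proof (rule inj_onI, clarify)
  fix i s j t
  assume ij: "i \<le> n" "j \<le> n"
    and eq: "suspension_vertices c a e (i, s) = suspension_vertices c a e (j, t)"
  have off: "e (k, u) \<noteq> c" "e (k, u) \<noteq> a" if "k < n" for k u
    using assms(3) that by auto
  have inj: "e (k, s) = e (l, t) \<longleftrightarrow> k = l \<and> s = t" if "k < n" "l < n" for k l
    using inj_onD[OF assms(1), of "(k, s)" "(l, t)"] that by auto
  show "i = j \<and> s = t"
    using ij eq assms(2) off inj
    by (cases i; cases j) (auto simp: suspension_vertices_def Suc_le_eq split: if_splits dest: sym)
qed

lemma antipodal_pairs_suspension:
  "antipodal_pairs (suspension_vertices c a e) (Suc n) = insert {c, a} (antipodal_pairs e n)"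
proof -
  have "antipodal_pairs (suspension_vertices c a e) (Suc n) =
     (\<lambda>i. {suspension_vertices c a e (i, True), suspension_vertices c a e (i, False)}) ` {..<Suc n}"
    by (auto simp: antipodal_pairs_def)
  also have "\<dots> = insert {c, a} ((\<lambda>i. {e (i, True), e (i, False)}) ` {..<n})"
    by (simp add: lessThan_Suc_eq_insert_0 image_image suspension_vertices_def)
  finally show ?thesis
    by (auto simp: antipodal_pairs_def)
qed

lemma cross_polytope_suspension:
  "cross_polytope (suspension_vertices c a e) (Suc n) =
    avoiding ({c, a} \<union> e ` ({..<n} \<times> UNIV)) (insert {c, a} (antipodal_pairs e n))"
  by (simp add: cross_polytope_def antipodal_pairs_suspension lessThan_Suc_atMost
      image_suspension_vertices)

text \<open>
  The left-hand side is the join of three points with a sphere: three cones, with apexes \<open>a\<close>, \<open>b\<close>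
  and \<open>c\<close>, over one cross-polytope on \<open>U\<close>. The right-hand side consists of two suspensions, with
  apexes \<open>a\<close>, \<open>c\<close> over \<open>U\<close> and \<open>b\<close>, \<open>c\<close> over a disjoint copy \<open>U'\<close>, and the two meet only in \<open>c\<close>.
  Geometrically, the bases of the cones over \<open>a\<close> and \<open>b\<close> are pulled apart inside the cone over \<open>c\<close>.

  In terms of forbidden sets, first every vertex of \<open>U\<close> is doubled: \<open>e' z\<close> obeys the same
  constraints as \<open>e z\<close> and is in addition incompatible with \<open>a\<close>, so it can be folded onto \<open>e z\<close>.
  Once the copy is there, the edges between \<open>b\<close> and \<open>U\<close> can be added, with \<open>e' z\<close> as apex for the
  edge from \<open>b\<close> to \<open>e z\<close>. Now \<open>c\<close> has only the neighbours \<open>a\<close> and \<open>b\<close>, where \<open>a\<close> is adjacent to all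
  of \<open>U'\<close> and \<open>b\<close> to all of \<open>U\<close>; hence \<open>c\<close> serves as apex for adding every edge between \<open>U\<close> and
  \<open>U'\<close>.
\<close>

lemma three_cones_same_type_two_cross_polytopes:
  fixes e e' :: "nat \<times> bool \<Rightarrow> 'a" and p :: nat
  defines "U \<equiv> e ` ({..<p} \<times> UNIV)" and "U' \<equiv> e' ` ({..<p} \<times> UNIV)"
  assumes inj: "inj_on e ({..<p} \<times> UNIV)" "inj_on e' ({..<p} \<times> UNIV)"
    and UU': "U \<inter> U' = {}"
    and abc: "distinct [a, b, c]" "{a, b, c} \<inter> (U \<union> U') = {}"
  shows "avoiding ({a, b, c} \<union> U) ({{a, b}, {b, c}, {a, c}} \<union> antipodal_pairs e p) \<simeq>
    cross_polytope (suspension_vertices c a e) (Suc p) \<union>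
    cross_polytope (suspension_vertices c b e') (Suc p)"
    (is "_ \<simeq> ?X1 \<union> ?X2")
proof -
  define I where "I = {..<p} \<times> (UNIV :: bool set)"
  \<comment> \<open>\<open>bar\<close> is the antipode; \<open>E\<close>, \<open>E'\<close> and \<open>D\<close> are the antipodal pairs of the doubled vertices.\<close>
  define bar where "bar = (\<lambda>z :: nat \<times> bool. (fst z, \<not> snd z))"
  let ?V = "{a, b, c} \<union> U \<union> U'"
  let ?tri = "{{a, b}, {b, c}, {a, c}}"
  define E where "E = (\<lambda>z. {e z, e (bar z)}) ` I"
  define E' where "E' = (\<lambda>z. {e' z, e' (bar z)}) ` I"
  define D where "D = (\<lambda>z. {e z, e' (bar z)}) ` I"
  define A where "A = (\<lambda>z. {a, e' z}) ` I"
  define B where "B = (\<lambda>z. {b, e z}) ` I"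
  define S where "S = (\<lambda>z. {e' z}) ` I"
  define W where "W = (\<lambda>(z, z'). {e z, e' z'}) ` (I \<times> I)"
  let ?F = "?tri \<union> E \<union> E' \<union> D \<union> A"
  have fin: "finite I" by (simp add: I_def)
  then have finV: "finite ?V" by (auto simp: U_def U'_def)
  have bar: "bar z \<in> I" "bar z \<noteq> z" "bar (bar z) = z" if "z \<in> I" for z
    using that by (auto simp: I_def bar_def prod_eq_iff split_beta)
  have U: "U = e ` I" "U' = e' ` I" by (simp_all add: U_def U'_def I_def)
  have e_eq: "e z = e y \<longleftrightarrow> z = y" if "z \<in> I" "y \<in> I" for y z
    using inj_on_eq_iff[OF inj(1)] that unfolding I_def by blast
  have e'_eq: "e' z = e' y \<longleftrightarrow> z = y" if "z \<in> I" "y \<in> I" for y z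
    using inj_on_eq_iff[OF inj(2)] that unfolding I_def by blast
  have ne: "e z \<noteq> e' y" "e z \<noteq> a" "e z \<noteq> b" "e z \<noteq> c" "e' y \<noteq> a" "e' y \<noteq> b" "e' y \<noteq> c"
    if "z \<in> I" "y \<in> I" for y z
    using UU' abc that unfolding U by auto
  have ab: "a \<noteq> b" "b \<noteq> c" "a \<noteq> c" using abc by auto
  have pairs: "antipodal_pairs g p = (\<lambda>z. {g z, g (bar z)}) ` I" for g :: "nat \<times> bool \<Rightarrow> 'a"
  proof -
    have "\<exists>i<p. {g z, g (bar z)} = {g (i, True), g (i, False)}" if "z \<in> I" for z
      using that by (cases z; cases "snd z") (auto simp: I_def bar_def)
    moreover have "(i, True) \<in> I \<and> bar (i, True) = (i, False)" if "i < p" for i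
      using that by (auto simp: I_def bar_def)
    ultimately show ?thesis
      unfolding antipodal_pairs_def by (auto simp: image_iff) metis+
  qed
  have E: "antipodal_pairs e p = E" and E': "antipodal_pairs e' p = E'"
    by (simp_all add: pairs E_def E'_def)
  have U'_free: "(\<forall>f\<in>S. \<not> f \<subseteq> \<sigma>) \<longleftrightarrow> \<sigma> \<inter> U' = {}" for \<sigma>
    by (auto simp: S_def U)
  have meet_U': "f \<inter> U' \<noteq> {}" if "f \<in> E' \<union> D \<union> A \<union> S \<union> W" for f
    using that bar by (auto simp: E'_def D_def A_def S_def W_def U)
  have meet_U: "f \<inter> U \<noteq> {}" if "f \<in> E \<union> D \<union> B \<union> W" for f
    using that bar by (auto simp: E_def D_def B_def W_def U)
  have mem: "{e z, e (bar z)} \<in> E" "{e' z, e' (bar z)} \<in> E'" "{e z, e' (bar z)} \<in> D"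
      "{a, e' z} \<in> A" "{b, e z} \<in> B" if "z \<in> I" for z
    using that unfolding E_def E'_def D_def A_def B_def by blast+
  have mem_D: "{e (bar z), e' z} \<in> D" if "z \<in> I" for z
    using mem(3)[OF bar(1)[OF that]] bar(3)[OF that] by simp
  have e_in: "f = {e z, e (bar z)} \<or> f = {e z, e' (bar z)}"
    if z: "z \<in> I" and f: "f \<in> ?F" "e z \<in> f" for f z
  proof -
    consider "f \<in> ?tri" | "f \<in> E" | "f \<in> E'" | "f \<in> D" | "f \<in> A"
      using f by blast
    then show ?thesis
    proof cases
      case 1
      then show ?thesis using f(2) ne[OF z z] by blast
    next
      case 2
      then obtain y where y: "y \<in> I" "f = {e y, e (bar y)}" unfolding E_def by blast
      then have "z = y \<or> z = bar y" using f(2) e_eq z bar(1) by blast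
      then show ?thesis using y bar(3)[OF y(1)] by (auto simp: insert_commute)
    next
      case 3
      then obtain y where y: "y \<in> I" "f = {e' y, e' (bar y)}" unfolding E'_def by blast
      then show ?thesis using f(2) ne(1)[OF z y(1)] ne(1)[OF z bar(1)[OF y(1)]] by simp
    next
      case 4
      then obtain y where y: "y \<in> I" "f = {e y, e' (bar y)}" unfolding D_def by blast
      then have "z = y" using f(2) e_eq[OF z y(1)] ne(1)[OF z bar(1)[OF y(1)]] by blast
      then show ?thesis using y by blast
    next
      case 5
      then show ?thesis using f(2) ne(1,2)[OF z] unfolding A_def by blast
    qed
  qed
  have e'_in: "f = {e' z, e' (bar z)} \<or> f = {e (bar z), e' z} \<or> f = {a, e' z}"
    if z: "z \<in> I" and f: "f \<in> ?F" "e' z \<in> f" for f z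
  proof -
    consider "f \<in> ?tri" | "f \<in> E" | "f \<in> E'" | "f \<in> D" | "f \<in> A"
      using f by blast
    then show ?thesis
    proof cases
      case 1
      then show ?thesis using f(2) ne[OF z z] by blast
    next
      case 2
      then obtain y where y: "y \<in> I" "f = {e y, e (bar y)}" unfolding E_def by blast
      then show ?thesis using f(2) ne(1)[OF y(1) z] ne(1)[OF bar(1)[OF y(1)] z] by simp
    next
      case 3
      then obtain y where y: "y \<in> I" "f = {e' y, e' (bar y)}" unfolding E'_def by blast
      then have "z = y \<or> z = bar y" using f(2) e'_eq z bar(1) by blast
      then show ?thesis using y bar(3)[OF y(1)] by (auto simp: insert_commute)
    next
      case 4
      then obtain y where y: "y \<in> I" "f = {e y, e' (bar y)}" unfolding D_def by blast
      then have "z = bar y" using f(2) e'_eq[OF z bar(1)[OF y(1)]] ne(1)[OF y(1) z] by auto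
      then show ?thesis using y bar(3)[OF y(1)] by simp
    next
      case 5
      then obtain y where y: "y \<in> I" "f = {a, e' y}" unfolding A_def by blast
      then show ?thesis using f(2) ne(5)[OF z z] e'_eq[OF z y(1)] by blast
    qed
  qed
  have "avoiding ({a, b, c} \<union> U) (?tri \<union> antipodal_pairs e p) = avoiding ?V (?F \<union> S)"
  proof (intro equalityI subsetI)
    fix \<sigma> assume \<sigma>: "\<sigma> \<in> avoiding ({a, b, c} \<union> U) (?tri \<union> antipodal_pairs e p)"
    then have "\<sigma> \<inter> U' = {}" using UU' abc by (auto simp: avoiding_def)
    then have "\<not> f \<subseteq> \<sigma>" if "f \<in> E' \<union> D \<union> A \<union> S" for f
      using meet_U'[of f] that by blast
    then show "\<sigma> \<in> avoiding ?V (?F \<union> S)"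
      using \<sigma> unfolding E avoiding_def by blast
  next
    fix \<sigma> assume \<sigma>: "\<sigma> \<in> avoiding ?V (?F \<union> S)"
    then have "\<sigma> \<inter> U' = {}" using U'_free[of \<sigma>] by (auto simp: avoiding_def)
    then show "\<sigma> \<in> avoiding ({a, b, c} \<union> U) (?tri \<union> antipodal_pairs e p)"
      using \<sigma> unfolding E avoiding_def by blast
  qed
  also have "\<dots> \<simeq> avoiding ?V ?F"
  proof (rule same_type_sym, rule avoiding_Un_same_type[OF finV])
    fix \<tau> assume "\<tau> \<in> S"
    then obtain z where z: "z \<in> I" "\<tau> = {e' z}" by (auto simp: S_def)
    show "\<exists>w\<in>?V. w \<notin> \<Union>S \<and> (\<forall>f\<in>?F. w \<in> f \<longrightarrow> (\<exists>g\<in>?F. g \<subseteq> \<tau> \<union> (f - {w})))"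
    proof (intro bexI[of _ "e z"] conjI ballI impI)
      fix f assume f: "f \<in> ?F" "e z \<in> f"
      have "{e (bar z), e' z} \<subseteq> \<tau> \<union> (f - {e z}) \<or> {e' z, e' (bar z)} \<subseteq> \<tau> \<union> (f - {e z})"
        using e_in[OF z(1) f] e_eq[OF z(1) bar(1)[OF z(1)]] ne(1)[OF z(1) bar(1)[OF z(1)]]
          bar(2)[OF z(1)] by (auto simp: z(2))
      then show "\<exists>g\<in>?F. g \<subseteq> \<tau> \<union> (f - {e z})"
        using mem_D[OF z(1)] mem(2)[OF z(1)] by (meson UnI1 UnI2)
    qed (use z ne in \<open>auto simp: S_def U\<close>)
  qed (use fin in \<open>auto simp: S_def\<close>)
  also have "\<dots> \<simeq> avoiding ?V (?F \<union> B)"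
  proof (rule avoiding_Un_same_type[OF finV])
    fix \<tau> assume "\<tau> \<in> B"
    then obtain z where z: "z \<in> I" "\<tau> = {b, e z}" by (auto simp: B_def)
    show "\<exists>w\<in>?V. w \<notin> \<Union>B \<and> (\<forall>f\<in>?F. w \<in> f \<longrightarrow> (\<exists>g\<in>?F. g \<subseteq> \<tau> \<union> (f - {w})))"
    proof (intro bexI[of _ "e' z"] conjI ballI impI)
      fix f assume f: "f \<in> ?F" "e' z \<in> f"
      have "{e z, e' (bar z)} \<subseteq> \<tau> \<union> (f - {e' z}) \<or> {e z, e (bar z)} \<subseteq> \<tau> \<union> (f - {e' z}) \<or>
          {a, b} \<subseteq> \<tau> \<union> (f - {e' z})"
        using e'_in[OF z(1) f] e'_eq[OF z(1) bar(1)[OF z(1)]] ne(1)[OF bar(1)[OF z(1)] z(1)]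
          ne(5)[OF z(1) z(1)] bar(2)[OF z(1)] by (auto simp: z(2))
      then show "\<exists>g\<in>?F. g \<subseteq> \<tau> \<union> (f - {e' z})"
        using mem(3)[OF z(1)] mem(1)[OF z(1)] by (meson UnI1 UnI2 insertI1)
    next
      show "e' z \<notin> \<Union>B" using ne(1)[OF _ z(1)] ne(6)[OF z(1) z(1)] by (auto simp: B_def dest: sym)
    qed (use z in \<open>auto simp: U\<close>)
  qed (use fin in \<open>auto simp: B_def\<close>)
  also have "\<dots> \<simeq> avoiding ?V (?F \<union> B \<union> W)"
  proof (rule avoiding_Un_same_type[OF finV])
    fix \<tau> assume "\<tau> \<in> W"
    then obtain z y where z: "z \<in> I" "y \<in> I" "\<tau> = {e z, e' y}" by (auto simp: W_def)
    show "\<exists>w\<in>?V. w \<notin> \<Union>W \<and>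
        (\<forall>f\<in>?F \<union> B. w \<in> f \<longrightarrow> (\<exists>g\<in>?F \<union> B. g \<subseteq> \<tau> \<union> (f - {w})))"
    proof (intro bexI[of _ c] conjI ballI impI)
      fix f assume f: "f \<in> ?F \<union> B" "c \<in> f"
      have "c \<notin> g" if "g \<in> E \<union> E' \<union> D \<union> A \<union> B" for g
      proof -
        have "g \<subseteq> {a, b} \<union> U \<union> U'"
          using that bar(1) by (auto simp: E_def E'_def D_def A_def B_def U)
        then show ?thesis using abc by auto
      qed
      then have "f = {b, c} \<or> f = {a, c}"
        using f ab by blast
      then have "{b, e z} \<subseteq> \<tau> \<union> (f - {c}) \<or> {a, e' y} \<subseteq> \<tau> \<union> (f - {c})"
        using ab by (auto simp: z(3))
      then show "\<exists>g\<in>?F \<union> B. g \<subseteq> \<tau> \<union> (f - {c})"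
        using mem(5)[OF z(1)] mem(4)[OF z(2)] by (meson UnI1 UnI2)
    next
      show "c \<notin> \<Union>W" using abc(2) by (auto simp: W_def U)
    qed auto
  qed (use fin in \<open>auto simp: W_def\<close>)
  also have "\<dots> = ?X1 \<union> ?X2"
  proof -
    have X1: "?X1 = avoiding ({c, a} \<union> U) (insert {c, a} E)"
      and X2: "?X2 = avoiding ({c, b} \<union> U') (insert {c, b} E')"
      by (simp_all only: cross_polytope_suspension E E' U_def U'_def)
    show ?thesis
    proof (intro equalityI subsetI)
      fix \<sigma> assume \<sigma>: "\<sigma> \<in> avoiding ?V (?F \<union> B \<union> W)"
      then have avoid: "\<And>f. f \<in> ?F \<union> B \<union> W \<Longrightarrow> \<not> f \<subseteq> \<sigma>" and \<sigma>V: "\<sigma> \<subseteq> ?V"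
        by (auto simp: avoiding_def)
      have tri: "\<not> (a \<in> \<sigma> \<and> b \<in> \<sigma>)" "\<not> (a \<in> \<sigma> \<and> c \<in> \<sigma>)" "\<not> (b \<in> \<sigma> \<and> c \<in> \<sigma>)"
        using avoid[of "{a, b}"] avoid[of "{a, c}"] avoid[of "{b, c}"] by auto
      have W: "\<not> (u \<in> \<sigma> \<and> u' \<in> \<sigma>)" if "u \<in> U" "u' \<in> U'" for u u'
        using avoid[of "{u, u'}"] that by (force simp: W_def U)
      have B: "\<not> (b \<in> \<sigma> \<and> u \<in> \<sigma>)" if "u \<in> U" for u
        using avoid[of "{b, u}"] that by (force simp: B_def U)
      have A: "\<not> (a \<in> \<sigma> \<and> u' \<in> \<sigma>)" if "u' \<in> U'" for u'
        using avoid[of "{a, u'}"] that by (force simp: A_def U)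
      have "\<sigma> \<subseteq> {c, a} \<union> U \<or> \<sigma> \<subseteq> {c, b} \<union> U'"
        using \<sigma>V tri W A B by blast
      then show "\<sigma> \<in> ?X1 \<union> ?X2"
        unfolding X1 X2 avoiding_def using tri avoid by auto
    next
      fix \<sigma> assume "\<sigma> \<in> ?X1 \<union> ?X2"
      then consider "\<sigma> \<subseteq> {c, a} \<union> U" "\<not> {c, a} \<subseteq> \<sigma>" "\<And>f. f \<in> E \<Longrightarrow> \<not> f \<subseteq> \<sigma>"
        | "\<sigma> \<subseteq> {c, b} \<union> U'" "\<not> {c, b} \<subseteq> \<sigma>" "\<And>f. f \<in> E' \<Longrightarrow> \<not> f \<subseteq> \<sigma>"
        unfolding X1 X2 avoiding_def by auto
      then show "\<sigma> \<in> avoiding ?V (?F \<union> B \<union> W)"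
      proof cases
        case 1
        then have no: "\<sigma> \<inter> U' = {}" "b \<notin> \<sigma>" using abc UU' by auto
        have "\<not> f \<subseteq> \<sigma>" if "f \<in> E' \<union> D \<union> A \<union> W" for f
          using meet_U'[of f] no that by blast
        moreover have "\<not> f \<subseteq> \<sigma>" if "f \<in> B \<union> ?tri" for f
          using that no 1(2) by (auto simp: B_def)
        ultimately show ?thesis
          using 1 unfolding avoiding_def by blast
      next
        case 2
        then have no: "\<sigma> \<inter> U = {}" "a \<notin> \<sigma>" using abc UU' by auto
        have "\<not> f \<subseteq> \<sigma>" if "f \<in> E \<union> D \<union> B \<union> W" for f
          using meet_U[of f] no that by blast
        moreover have "\<not> f \<subseteq> \<sigma>" if "f \<in> A \<union> ?tri" for f
          using that no 2(2) by (auto simp: A_def)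
        ultimately show ?thesis
          using 2 unfolding avoiding_def by blast
      qed
    qed
  qed
  finally show ?thesis .
qed

text \<open>
  Infinitely many vertex names provide a disjoint copy of the cross-polytope.
\<close>

lemma three_cones_homotopy_equivalent_wedge:
  fixes e :: "nat \<times> bool \<Rightarrow> 'a"
  assumes inf: "infinite (UNIV :: 'a set)"
    and inj: "inj_on e ({..<p} \<times> UNIV)"
    and abc: "distinct [a, b, c]" "{a, b, c} \<inter> e ` ({..<p} \<times> UNIV) = {}"
  shows "geometric_realization
      (avoiding ({a, b, c} \<union> e ` ({..<p} \<times> UNIV)) ({{a, b}, {b, c}, {a, c}} \<union> antipodal_pairs e p))
    homotopy_equivalent_space wedge_of_spheres 2 p"
proof -
  obtain e' :: "nat \<times> bool \<Rightarrow> 'a"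
    where e': "inj e'" "range e' \<inter> ({a, b, c} \<union> e ` ({..<p} \<times> UNIV)) = {}"
    by (rule infinite_fresh_injection[OF inf, of "{a, b, c} \<union> e ` ({..<p} \<times> UNIV)"]) auto
  then have inj': "inj_on e' ({..<p} \<times> UNIV)"
    by (meson inj_on_subset subset_UNIV)
  define v where "v k = (if k = 0 then suspension_vertices c a e else suspension_vertices c b e')"
    for k :: nat
  have "inj_on (v k) ({..p} \<times> UNIV)" for k
    unfolding v_def using abc e' by (auto intro!: inj_suspension_vertices inj inj')
  moreover have "v k (0, True) = c" for k
    by (simp add: v_def suspension_vertices_def)
  moreover have "v 0 ` ({..p} \<times> UNIV) \<inter> v 1 ` ({..p} \<times> UNIV) \<subseteq> {c}"
  proof -
    have "e' ` ({..<p} \<times> UNIV) \<inter> ({a, b, c} \<union> e ` ({..<p} \<times> UNIV)) = {}"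
      using e'(2) by blast
    then show ?thesis
      using abc by (simp add: v_def image_suspension_vertices) blast
  qed
  ultimately have "geometric_realization (cross_polytope (v 0) (Suc p) \<union> cross_polytope (v 1) (Suc p))
      homeomorphic_space wedge_of_spheres 2 p"
    by (intro two_cross_polytopes_homeomorphic_wedge[of v]) auto
  then have "geometric_realization (cross_polytope (suspension_vertices c a e) (Suc p) \<union>
      cross_polytope (suspension_vertices c b e') (Suc p))
      homotopy_equivalent_space wedge_of_spheres 2 p"
    by (simp add: v_def homeomorphic_imp_homotopy_equivalent_space)
  moreover have "e' ` ({..<p} \<times> UNIV) \<inter> ({a, b, c} \<union> e ` ({..<p} \<times> UNIV)) = {}"
    using e'(2) by blast
  then have "{a, b, c} \<inter> (e ` ({..<p} \<times> UNIV) \<union> e' ` ({..<p} \<times> UNIV)) = {}"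
      "e ` ({..<p} \<times> UNIV) \<inter> e' ` ({..<p} \<times> UNIV) = {}"
    using abc(2) by blast+
  ultimately show ?thesis
    using three_cones_same_type_two_cross_polytopes[OF inj inj' _ abc(1)]
    unfolding same_type_def by (blast intro: homotopy_eqv_trans)
qed

section \<open>Peeling rows off a cylinder\<close>

lemma avoiding_cong:
  assumes "\<And>f. f \<in> F \<Longrightarrow> f \<subseteq> V \<Longrightarrow> \<exists>g\<in>G. g \<subseteq> f"
    and "\<And>g. g \<in> G \<Longrightarrow> g \<subseteq> V \<Longrightarrow> \<exists>f\<in>F. f \<subseteq> g"
  shows "avoiding V F = avoiding V G"
proof -
  have "\<sigma> \<in> avoiding V F \<longleftrightarrow> \<sigma> \<in> avoiding V G" for \<sigma>
    using assms unfolding avoiding_def mem_Collect_eq by (meson subset_trans)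
  then show ?thesis by blast
qed

lemma avoiding_singletons: "avoiding V (F \<union> (\<lambda>v. {v}) ` S) = avoiding (V - S) F"
  by (auto simp: avoiding_def)

lemma avoiding_minimal:
  assumes "\<forall>g\<in>G. \<exists>h\<in>H. h \<subseteq> g" and "H \<subseteq> G"
  shows "avoiding V (F \<union> G) = avoiding V (F \<union> H)"
  by (rule avoiding_cong) (use assms in blast)+

text \<open>
  The core of the recursion. Here \<open>a\<close>, \<open>b\<close>, \<open>c\<close> are the columns of a triangular prism, rows 1, 2, 3
  are the last rows counted from its end, and \<open>F\<close> stands for the rest of the graph, attached to
  row 3 only. In each operation below the witness given to \<open>move\<close> is the apex.

  The edges from \<open>c2\<close> to \<open>a2\<close> and \<open>b2\<close> are redundant (apexes \<open>b1\<close> and \<open>a1\<close>). Without them \<open>c2\<close> has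
  only the neighbours \<open>c1\<close> and \<open>c3\<close>, so \<open>a1\<close> and then \<open>b1\<close>, already adjacent to \<open>c1\<close>, can be folded
  away as soon as they are joined to \<open>c3\<close>. This leaves \<open>c1\<close> with the single neighbour \<open>c2\<close>, which
  removes \<open>c3\<close>; then \<open>a2\<close> and \<open>b2\<close> remove \<open>b3\<close> and \<open>a3\<close>. What survives of the three rows is two
  isolated edges.
\<close>

lemma three_end_rows_same_type:
  assumes V: "finite V" "{a1, b1, c1, a2, b2, c2, a3, b3, c3} \<subseteq> V"
    and dist: "distinct [a1, b1, c1, a2, b2, c2, a3, b3, c3]"
    and F: "\<Union>F \<inter> {a1, b1, c1, a2, b2, c2} = {}"
  shows "avoiding V (F \<union> {{a1, b1}, {b1, c1}, {a1, c1}} \<union> {{a2, b2}, {b2, c2}, {a2, c2}} \<union>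
        {{a3, b3}, {b3, c3}, {a3, c3}} \<union> {{a2, a1}, {b2, b1}, {c2, c1}} \<union>
        {{a3, a2}, {b3, b2}, {c3, c2}})
    \<simeq> avoiding V (F \<union> {{c1, c2}, {a2, b2}} \<union> {{a1}, {b1}, {a3}, {b3}, {c3}})"
proof -
  have ne: "a1 \<noteq> b1" "a1 \<noteq> c1" "a1 \<noteq> a2" "a1 \<noteq> b2" "a1 \<noteq> c2" "a1 \<noteq> a3" "a1 \<noteq> b3" "a1 \<noteq> c3"
      "b1 \<noteq> c1" "b1 \<noteq> a2" "b1 \<noteq> b2" "b1 \<noteq> c2" "b1 \<noteq> a3" "b1 \<noteq> b3" "b1 \<noteq> c3"
      "c1 \<noteq> a2" "c1 \<noteq> b2" "c1 \<noteq> c2" "c1 \<noteq> a3" "c1 \<noteq> b3" "c1 \<noteq> c3"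
      "a2 \<noteq> b2" "a2 \<noteq> c2" "a2 \<noteq> a3" "a2 \<noteq> b3" "a2 \<noteq> c3"
      "b2 \<noteq> c2" "b2 \<noteq> a3" "b2 \<noteq> b3" "b2 \<noteq> c3" "c2 \<noteq> a3" "c2 \<noteq> b3" "c2 \<noteq> c3"
      "a3 \<noteq> b3" "a3 \<noteq> c3" "b3 \<noteq> c3"
    using dist by simp_all
  note ne = ne ne[symmetric]
  have move: "avoiding V (F \<union> G) \<simeq> avoiding V (F \<union> insert \<tau> G)"
    if w: "w \<in> {a1, b1, c1, a2, b2, c2}" and \<tau>: "w \<notin> \<tau>" "\<tau> \<noteq> {}"
      and cone: "\<forall>f\<in>G. w \<in> f \<longrightarrow> (\<exists>g\<in>G. g \<subseteq> \<tau> \<union> (f - {w}))" for w \<tau> G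
  proof -
    have "w \<in> V" "w \<notin> \<Union>F" using w V(2) F by blast+
    then have "\<exists>g\<in>F \<union> G. g \<subseteq> \<tau> \<union> (f - {w})" if "f \<in> F \<union> G" "w \<in> f" for f
      using that cone by blast
    then show ?thesis
      using avoiding_insert_same_type[OF V(1) \<open>w \<in> V\<close> \<tau>, of "F \<union> G"] by simp
  qed
  \<comment> \<open>The three rows without the edges \<open>a2 c2\<close> and \<open>b2 c2\<close>: steps 1 and 2 restore these edges,
    steps 3 to 9 reduce the graph further.\<close>
  let ?G = "{{a1, b1}, {b1, c1}, {a1, c1}, {a2, b2}, {a3, b3}, {b3, c3}, {a3, c3},
     {a2, a1}, {b2, b1}, {c2, c1}, {a3, a2}, {b3, b2}, {c3, c2}}"
  have 1: "avoiding V (F \<union> ?G) \<simeq> avoiding V (F \<union> insert {a2, c2} ?G)"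
    by (rule move[of b1]) (simp_all add: ne)
  have 2: "avoiding V (F \<union> insert {a2, c2} ?G) \<simeq> avoiding V (F \<union> insert {b2, c2} (insert {a2, c2} ?G))"
    by (rule move[of a1]) (simp_all add: ne)
  let ?G1 = "insert {a1} (insert {a1, c3} ?G)"
  have 3: "avoiding V (F \<union> ?G) \<simeq> avoiding V (F \<union> insert {a1, c3} ?G)"
    by (rule move[of b2]) (simp_all add: ne)
  have 4: "avoiding V (F \<union> insert {a1, c3} ?G) \<simeq> avoiding V (F \<union> ?G1)"
    by (rule move[of c2]) (simp_all add: ne)
  let ?G2 = "insert {b1} (insert {b1, c3} ?G1)"
  have 5: "avoiding V (F \<union> ?G1) \<simeq> avoiding V (F \<union> insert {b1, c3} ?G1)"
    by (rule move[of a2]) (simp_all add: ne)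
  have 6: "avoiding V (F \<union> insert {b1, c3} ?G1) \<simeq> avoiding V (F \<union> ?G2)"
    by (rule move[of c2]) (simp_all add: ne)
  let ?G3 = "insert {a3} (insert {b3} (insert {c3} ?G2))"
  have 7: "avoiding V (F \<union> ?G2) \<simeq> avoiding V (F \<union> insert {c3} ?G2)"
    by (rule move[of c1]) (simp_all add: ne)
  have 8: "avoiding V (F \<union> insert {c3} ?G2) \<simeq> avoiding V (F \<union> insert {b3} (insert {c3} ?G2))"
    by (rule move[of a2]) (simp_all add: ne)
  have 9: "avoiding V (F \<union> insert {b3} (insert {c3} ?G2)) \<simeq> avoiding V (F \<union> ?G3)"
    by (rule move[of b2]) (simp_all add: ne)
  let ?L = "F \<union> {{a1, b1}, {b1, c1}, {a1, c1}} \<union> {{a2, b2}, {b2, c2}, {a2, c2}} \<union>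
        {{a3, b3}, {b3, c3}, {a3, c3}} \<union> {{a2, a1}, {b2, b1}, {c2, c1}} \<union>
        {{a3, a2}, {b3, b2}, {c3, c2}}"
  have "?L = F \<union> insert {b2, c2} (insert {a2, c2} ?G)"
    by (simp add: insert_commute Un_assoc)
  then have "avoiding V ?L \<simeq> avoiding V (F \<union> ?G)"
    using same_type_sym[OF same_type_trans[OF 1 2]] by simp
  also have "\<dots> \<simeq> avoiding V (F \<union> ?G3)"
    by (rule same_type_trans[OF 3 same_type_trans[OF 4 same_type_trans[OF 5
          same_type_trans[OF 6 same_type_trans[OF 7 same_type_trans[OF 8 9]]]]]])
  also have "avoiding V (F \<union> ?G3) =
      avoiding V (F \<union> {{c1, c2}, {a2, b2}, {a1}, {b1}, {a3}, {b3}, {c3}})"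
    by (rule avoiding_minimal) (simp, simp add: insert_commute)
  also have "F \<union> {{c1, c2}, {a2, b2}, {a1}, {b1}, {a3}, {b3}, {c3}} =
      F \<union> {{c1, c2}, {a2, b2}} \<union> {{a1}, {b1}, {a3}, {b3}, {c3}}"
    by (simp only: Un_assoc Un_insert_left Un_empty_left)
  finally show ?thesis .
qed

definition row_edges :: "nat \<Rightarrow> (nat \<times> nat) set set" where
  "row_edges i = {{(i, 1), (i, 2)}, {(i, 2), (i, 3)}, {(i, 1), (i, 3)}}"

definition rung_edges :: "nat \<Rightarrow> (nat \<times> nat) set set" where
  "rung_edges i = {{(i, 1), (Suc i, 1)}, {(i, 2), (Suc i, 2)}, {(i, 3), (Suc i, 3)}}"

definition cylinder_edges :: "nat \<Rightarrow> (nat \<times> nat) set set" where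
  "cylinder_edges m = (\<Union>i\<in>{1..m}. row_edges i) \<union> (\<Union>i\<in>{1..<m}. rung_edges i)"

lemma atLeastAtMost_1_3: "{1..3} = {1, 2, 3 :: nat}"
  by auto

text \<open>
  Any two distinct residues modulo 3 differ by \<open>1\<close> or \<open>-1\<close>, so every row is a triangle.
\<close>

lemma independence_complex_cylinder:
  "independence_complex (cylinder_graph m 3) = avoiding ({1..m} \<times> {1..3}) (cylinder_edges m)"
proof -
  let ?V = "{1..m} \<times> {1..3 :: nat}"
  have cong3: "[int j - int k = 1] (mod 3) \<or> [int j - int k = - 1] (mod 3)"
    if "j \<in> {1..3}" "k \<in> {1..3}" "j \<noteq> k" for j k
    using that unfolding atLeastAtMost_1_3 cong_def by auto
  have arcs: "(u, v) \<in> parcs (cylinder_graph m 3) \<longleftrightarrow> {u, v} \<in> cylinder_edges m"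
    if uv: "u \<in> ?V" "v \<in> ?V" for u v
  proof -
    obtain i j k l where u: "u = (i, j)" and v: "v = (k, l)" by (cases u; cases v) auto
    have j: "j = 1 \<or> j = 2 \<or> j = 3" "l = 1 \<or> l = 2 \<or> l = 3"
      using uv unfolding u v atLeastAtMost_1_3 by auto
    have "(u, v) \<in> parcs (cylinder_graph m 3) \<longleftrightarrow>
        (i = k \<and> j \<noteq> l) \<or> (j = l \<and> (i = Suc k \<or> k = Suc i))"
      using uv cong3[of j l] unfolding u v by (auto simp: cylinder_graph_def Let_def)
    also have "\<dots> \<longleftrightarrow> {u, v} \<in> cylinder_edges m"
    proof -
      have "{u, v} \<in> row_edges n \<longleftrightarrow> i = n \<and> k = n \<and> j \<noteq> l" for n
        using j unfolding u v row_edges_def by (elim disjE) (auto simp: doubleton_eq_iff)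
      moreover have "{u, v} \<in> rung_edges n \<longleftrightarrow> j = l \<and> (i = n \<and> k = Suc n \<or> k = n \<and> i = Suc n)" for n
        using j unfolding u v rung_edges_def by (elim disjE) (auto simp: doubleton_eq_iff)
      ultimately show ?thesis
        using uv unfolding cylinder_edges_def u v by auto
    qed
    finally show ?thesis .
  qed
  have pairs: "\<exists>u v. f = {u, v}" if "f \<in> cylinder_edges m" for f
    using that unfolding cylinder_edges_def row_edges_def rung_edges_def by blast
  show ?thesis
  proof (intro equalityI subsetI)
    fix \<sigma> assume "\<sigma> \<in> independence_complex (cylinder_graph m 3)"
    then have sub: "\<sigma> \<subseteq> ?V" and ind: "\<And>u v. u \<in> \<sigma> \<Longrightarrow> v \<in> \<sigma> \<Longrightarrow> (u, v) \<notin> parcs (cylinder_graph m 3)"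
      by (auto simp: independence_complex_def cylinder_graph_def Let_def)
    have "\<not> f \<subseteq> \<sigma>" if f: "f \<in> cylinder_edges m" for f
    proof
      assume "f \<subseteq> \<sigma>"
      moreover obtain u v where "f = {u, v}" using pairs[OF f] by blast
      ultimately have uv: "u \<in> \<sigma>" "v \<in> \<sigma>" by auto
      then have "u \<in> ?V" "v \<in> ?V" using sub by (metis subsetD)+
      then show False using arcs ind[OF uv] f \<open>f = {u, v}\<close> by simp
    qed
    then show "\<sigma> \<in> avoiding ?V (cylinder_edges m)"
      using sub by (auto simp: avoiding_def)
  next
    fix \<sigma> assume \<sigma>: "\<sigma> \<in> avoiding ?V (cylinder_edges m)"
    then have sub: "\<sigma> \<subseteq> ?V" by (simp add: avoiding_def)
    have "(u, v) \<notin> parcs (cylinder_graph m 3)" if "u \<in> \<sigma>" "v \<in> \<sigma>" for u v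
    proof -
      have "{u, v} \<subseteq> \<sigma>" using that by simp
      then have "{u, v} \<notin> cylinder_edges m"
        using \<sigma> unfolding avoiding_def by blast
      moreover have "u \<in> ?V" "v \<in> ?V" using that sub by (metis subsetD)+
      ultimately show ?thesis using arcs by simp
    qed
    moreover have "pverts (cylinder_graph m 3) = ?V"
      by (simp add: cylinder_graph_def Let_def)
    ultimately show "\<sigma> \<in> independence_complex (cylinder_graph m 3)"
      using sub by (simp add: independence_complex_def)
  qed
qed

text \<open>
  The independence complex of a cylinder together with \<open>p\<close> isolated edges on further vertices. This
  is the form that the recursion preserves; topologically it is the \<open>p\<close>-fold suspension of the
  independence complex of the cylinder.
\<close>

definition cylinder_with_pairs :: "nat \<Rightarrow> (nat \<times> bool \<Rightarrow> nat \<times> nat) \<Rightarrow> nat \<Rightarrow> (nat \<times> nat) set set" where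
  "cylinder_with_pairs m e p =
     avoiding ({1..m} \<times> {1..3} \<union> e ` ({..<p} \<times> UNIV)) (cylinder_edges m \<union> antipodal_pairs e p)"

lemma image_add_pair:
  "e((p, True) := x, (p, False) := y) ` ({..<Suc p} \<times> UNIV) = {x, y} \<union> e ` ({..<p} \<times> UNIV)"
proof -
  have "{..<Suc p} \<times> UNIV = {(p, True), (p, False)} \<union> {..<p} \<times> UNIV"
    by (auto simp: lessThan_Suc UNIV_bool)
  moreover have "e((p, True) := x, (p, False) := y) ` ({..<p} \<times> UNIV) = e ` ({..<p} \<times> UNIV)"
    by (intro image_cong) auto
  ultimately show ?thesis by (simp add: image_Un)
qed

lemma inj_add_pair:
  assumes "inj_on e ({..<p} \<times> UNIV)" "x \<noteq> y" "{x, y} \<inter> e ` ({..<p} \<times> UNIV) = {}"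
  shows "inj_on (e((p, True) := x, (p, False) := y)) ({..<Suc p} \<times> UNIV)"
proof -
  let ?e = "e((p, True) := x, (p, False) := y)"
  have "{..<Suc p} \<times> UNIV = {(p, True), (p, False)} \<union> {..<p} \<times> UNIV"
    by (auto simp: lessThan_Suc UNIV_bool)
  moreover have "?e ` ({..<p} \<times> UNIV) = e ` ({..<p} \<times> UNIV)"
    by (intro image_cong) auto
  moreover have "inj_on ?e ({..<p} \<times> UNIV)"
    using assms(1) by (rule inj_on_cong[THEN iffD1, rotated]) auto
  ultimately show ?thesis
    using assms(2,3) by (auto simp: inj_on_Un)
qed

lemma antipodal_pairs_add_pair:
  "antipodal_pairs (e((p, True) := x, (p, False) := y)) (Suc p) = insert {x, y} (antipodal_pairs e p)"
  unfolding antipodal_pairs_def by (auto simp: less_Suc_eq)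

text \<open>
  The last two rows \<open>m + 2\<close>, \<open>m + 1\<close> and the row \<open>m\<close> play the parts of rows 1, 2, 3. To cover a
  cylinder with only two rows as well, a row \<open>m = 0\<close> is present as forbidden vertices: the family
  \<open>D\<close>. The truncated subtraction \<open>m - 1\<close> then leaves no rows, as it should.
\<close>

lemma cylinder_peel_three_rows:
  assumes inj: "inj_on e ({..<p} \<times> UNIV)" and e: "e ` ({..<p} \<times> UNIV) \<subseteq> {m + 2<..} \<times> UNIV"
  obtains e' where "inj_on e' ({..<p + 2} \<times> UNIV)"
    "e' ` ({..<p + 2} \<times> UNIV) \<subseteq> {m - 1<..} \<times> UNIV"
    "cylinder_with_pairs (m + 2) e p \<simeq> cylinder_with_pairs (m - 1) e' (p + 2)"
proof -
  define U where "U = e ` ({..<p} \<times> UNIV)"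
  have "U \<subseteq> {m + 2<..} \<times> UNIV" using e by (simp add: U_def)
  then have U: "m + 2 < fst v" if "v \<in> U" for v
    using that by (auto simp: mem_Times_iff dest: subsetD)
  have finU: "finite U" by (simp add: U_def)
  let ?v = "\<lambda>k j. (m + k, j) :: nat \<times> nat"
  define R where "R = {m} \<times> {1..3 :: nat}"
  define V where "V = {1..m + 2} \<times> {1..3} \<union> R \<union> U"
  define D where "D = (if m = 0 then (\<lambda>v. {v}) ` R else {})"
  define F where "F = cylinder_edges m \<union> antipodal_pairs e p \<union> D"
  define S where "S = {?v 2 1, ?v 2 2, ?v 0 1, ?v 0 2, ?v 0 3}"
  let ?E = "row_edges (m + 2) \<union> row_edges (m + 1) \<union> row_edges m \<union> rung_edges (m + 1) \<union> rung_edges m"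
  let ?K2 = "{{?v 2 3, ?v 1 3}, {?v 1 1, ?v 1 2}}"
  have pairs_U: "\<Union>(antipodal_pairs e p) \<subseteq> U"
    by (auto simp: antipodal_pairs_def U_def)
  have cyl_rows: "\<Union>(cylinder_edges n) \<subseteq> {1..n} \<times> {1..3}" for n
    by (auto simp: cylinder_edges_def row_edges_def rung_edges_def)
  have cyl: "cylinder_edges (m + 2) =
      cylinder_edges m \<union> row_edges (m + 1) \<union> row_edges (m + 2) \<union> rung_edges (m + 1) \<union>
      (if m = 0 then {} else rung_edges m)"
  proof -
    have "{1..m + 2} = {1..m} \<union> {m + 1, m + 2}"
      "{1..<m + 2} = {1..<m} \<union> (if m = 0 then {m + 1} else {m, m + 1})"
      by auto
    then show ?thesis by (auto simp: cylinder_edges_def)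
  qed
  have "cylinder_with_pairs (m + 2) e p = avoiding V (F \<union> ?E)"
  proof (cases "m = 0")
    case True
    have "v \<notin> U \<union> {1..m + 2} \<times> {1..3}" if "v \<in> R" for v
      using U[of v] True that by (auto simp: R_def)
    then have "V - R = {1..m + 2} \<times> {1..3} \<union> U"
      unfolding V_def by blast
    then have "cylinder_with_pairs (m + 2) e p =
        avoiding (V - R) (cylinder_edges (m + 2) \<union> antipodal_pairs e p)"
      by (simp add: cylinder_with_pairs_def U_def)
    also have "\<dots> = avoiding V (cylinder_edges (m + 2) \<union> antipodal_pairs e p \<union> (\<lambda>v. {v}) ` R)"
      by (rule avoiding_singletons[symmetric])
    also have "\<dots> = avoiding V (F \<union> ?E)"
    proof (rule avoiding_cong)
      fix f assume "f \<in> cylinder_edges (m + 2) \<union> antipodal_pairs e p \<union> (\<lambda>v. {v}) ` R"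
      then have "f \<in> F \<union> ?E" unfolding cyl F_def D_def using True by auto
      then show "\<exists>g\<in>F \<union> ?E. g \<subseteq> f" by blast
    next
      fix f assume "f \<in> F \<union> ?E"
      then consider "f \<in> cylinder_edges (m + 2) \<union> antipodal_pairs e p \<union> (\<lambda>v. {v}) ` R"
        | "f \<in> row_edges m \<union> rung_edges m"
        unfolding cyl F_def D_def using True by auto
      then show "\<exists>g\<in>cylinder_edges (m + 2) \<union> antipodal_pairs e p \<union> (\<lambda>v. {v}) ` R. g \<subseteq> f"
      proof cases
        case 2
        then have "\<exists>v\<in>R. v \<in> f"
          by (auto simp: row_edges_def rung_edges_def R_def)
        then show ?thesis by blast
      qed blast
    qed
    finally show ?thesis .
  next
    case False
    have "{1..m + 2} \<times> {1..3} \<union> U = V"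
      using False by (auto simp: V_def R_def)
    moreover have "row_edges m \<subseteq> cylinder_edges m"
      using False by (auto simp: cylinder_edges_def)
    then have "cylinder_edges (m + 2) \<union> antipodal_pairs e p = F \<union> ?E"
      unfolding cyl F_def D_def using False by auto
    ultimately show ?thesis
      by (simp add: cylinder_with_pairs_def U_def)
  qed
  also have "avoiding V (F \<union> ?E) = avoiding V (F \<union>
      {{?v 2 1, ?v 2 2}, {?v 2 2, ?v 2 3}, {?v 2 1, ?v 2 3}} \<union>
      {{?v 1 1, ?v 1 2}, {?v 1 2, ?v 1 3}, {?v 1 1, ?v 1 3}} \<union>
      {{?v 0 1, ?v 0 2}, {?v 0 2, ?v 0 3}, {?v 0 1, ?v 0 3}} \<union>
      {{?v 1 1, ?v 2 1}, {?v 1 2, ?v 2 2}, {?v 1 3, ?v 2 3}} \<union>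
      {{?v 0 1, ?v 1 1}, {?v 0 2, ?v 1 2}, {?v 0 3, ?v 1 3}})"
    by (simp add: row_edges_def rung_edges_def Un_assoc)
  also have "\<dots> \<simeq> avoiding V (F \<union> ?K2 \<union> {{?v 2 1}, {?v 2 2}, {?v 0 1}, {?v 0 2}, {?v 0 3}})"
  proof (rule three_end_rows_same_type)
    show "finite V" using finU by (simp add: V_def R_def)
    show "{?v 2 1, ?v 2 2, ?v 2 3, ?v 1 1, ?v 1 2, ?v 1 3, ?v 0 1, ?v 0 2, ?v 0 3} \<subseteq> V"
      by (auto simp: V_def R_def)
    have "\<Union>D \<subseteq> R" by (simp add: D_def)
    then have sub: "\<Union>F \<subseteq> {1..m} \<times> {1..3} \<union> U \<union> R"
      using pairs_U cyl_rows[of m] unfolding F_def Union_Un_distrib by blast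
    have "(k, j) \<notin> \<Union>F" if "k = m + 1 \<or> k = m + 2" for k j
    proof
      assume "(k, j) \<in> \<Union>F"
      then have "(k, j) \<in> {1..m} \<times> {1..3} \<or> (k, j) \<in> U \<or> (k, j) \<in> R"
        using sub by blast
      then show False using that U[of "(k, j)"] by (auto simp: R_def)
    qed
    then show "\<Union>F \<inter> {?v 2 1, ?v 2 2, ?v 2 3, ?v 1 1, ?v 1 2, ?v 1 3} = {}"
      by blast
    show "distinct [?v 2 1, ?v 2 2, ?v 2 3, ?v 1 1, ?v 1 2, ?v 1 3, ?v 0 1, ?v 0 2, ?v 0 3]"
      by simp
  qed
  also have "\<dots> = avoiding (V - S) (F \<union> ?K2)"
  proof -
    have "{{?v 2 1}, {?v 2 2}, {?v 0 1}, {?v 0 2}, {?v 0 3}} = (\<lambda>v. {v}) ` S"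
      by (simp only: S_def image_insert image_empty)
    then show ?thesis by (simp only: avoiding_singletons)
  qed
  also have "\<dots> = avoiding (V - S) (cylinder_edges (m - 1) \<union> antipodal_pairs e p \<union> ?K2)"
  proof (rule avoiding_cong)
    have R: "\<not> f \<subseteq> V - S" if "v \<in> R" "v \<in> f" for f v
      using that unfolding R_def S_def atLeastAtMost_1_3 by auto
    fix f assume f: "f \<in> F \<union> ?K2" "f \<subseteq> V - S"
    have R': "v \<notin> f" if "v \<in> R" for v
      using R[OF that] f(2) by blast
    have low: "(m, 1) \<notin> f" "(m, 2) \<notin> f" "(m, 3) \<notin> f"
      by (rule R', simp add: R_def)+
    have "f \<in> cylinder_edges (m - 1)" if cyl_m: "f \<in> cylinder_edges m"
    proof -
      consider i where "i \<in> {1..m}" "f \<in> row_edges i" | i where "i \<in> {1..<m}" "f \<in> rung_edges i"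
        using cyl_m unfolding cylinder_edges_def by blast
      then show ?thesis
      proof cases
        case 1
        then have "i \<noteq> m" using low by (auto simp: row_edges_def)
        then show ?thesis using 1 unfolding cylinder_edges_def by (intro UnI1 UN_I[of i]) auto
      next
        case 2
        then have "Suc i \<noteq> m" using low by (auto simp: rung_edges_def)
        then show ?thesis using 2 unfolding cylinder_edges_def by (intro UnI2 UN_I[of i]) auto
      qed
    qed
    moreover have "f \<notin> D"
      using R' by (auto simp: D_def)
    ultimately show "\<exists>g\<in>cylinder_edges (m - 1) \<union> antipodal_pairs e p \<union> ?K2. g \<subseteq> f"
      using f(1) unfolding F_def by blast
  next
    have "cylinder_edges (m - 1) \<subseteq> cylinder_edges m"
      unfolding cylinder_edges_def by (intro Un_mono UN_mono) auto
    then show "\<exists>g\<in>F \<union> ?K2. g \<subseteq> f"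
      if "f \<in> cylinder_edges (m - 1) \<union> antipodal_pairs e p \<union> ?K2" for f
      using that unfolding F_def by blast
  qed
  finally have reduced: "cylinder_with_pairs (m + 2) e p \<simeq>
    avoiding (V - S) (cylinder_edges (m - 1) \<union> antipodal_pairs e p \<union> ?K2)" .
  define e1 where "e1 = e((p, True) := ?v 2 3, (p, False) := ?v 1 3)"
  define e2 where "e2 = e1((Suc p, True) := ?v 1 1, (Suc p, False) := ?v 1 2)"
  have not_U: "(m, j) \<notin> U" "(Suc m, j) \<notin> U" "(Suc (Suc m), j) \<notin> U" for j
    using U[of "(m, j)"] U[of "(Suc m, j)"] U[of "(Suc (Suc m), j)"] by auto
  have im1: "e1 ` ({..<Suc p} \<times> UNIV) = {?v 2 3, ?v 1 3} \<union> U"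
    unfolding e1_def U_def by (rule image_add_pair)
  define M where "M = {?v 1 1, ?v 1 2, ?v 1 3, ?v 2 3}"
  have p2: "p + 2 = Suc (Suc p)" by simp
  have im2: "e2 ` ({..<p + 2} \<times> UNIV) = M \<union> U"
    unfolding p2 e2_def image_add_pair im1 M_def by auto
  have "inj_on e1 ({..<Suc p} \<times> UNIV)"
    unfolding e1_def by (rule inj_add_pair[OF inj]) (use not_U in \<open>auto simp: U_def[symmetric]\<close>)
  then have inj2: "inj_on e2 ({..<p + 2} \<times> UNIV)"
    unfolding p2 e2_def by (rule inj_add_pair) (use not_U in \<open>auto simp: im1\<close>)
  have pairs2: "antipodal_pairs e2 (p + 2) = antipodal_pairs e p \<union> ?K2"
    unfolding p2 e2_def e1_def antipodal_pairs_add_pair by blast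
  have V_S: "V - S = {1..m - 1} \<times> {1..3} \<union> e2 ` ({..<p + 2} \<times> UNIV)"
  proof -
    have rows: "{1..m + 2} \<union> {m} = {1..m - 1} \<union> {m, m + 1, m + 2}" by auto
    have "V = ({1..m - 1} \<union> {m, m + 1, m + 2}) \<times> {1..3} \<union> U"
      unfolding V_def R_def Sigma_Un_distrib1[symmetric] rows ..
    also have "\<dots> = {1..m - 1} \<times> {1..3} \<union> {m, m + 1, m + 2} \<times> {1..3} \<union> U"
      unfolding Sigma_Un_distrib1 ..
    also have "{m, m + 1, m + 2} \<times> {1..3} = S \<union> M"
      unfolding atLeastAtMost_1_3 S_def M_def by auto
    finally have "V = {1..m - 1} \<times> {1..3} \<union> (S \<union> M) \<union> U" .
    moreover have "S \<inter> U = {}" "S \<inter> {1..m - 1} \<times> {1..3} = {}" "S \<inter> M = {}"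
      using not_U by (auto simp: S_def M_def)
    ultimately show ?thesis
      unfolding im2 by blast
  qed
  have "cylinder_with_pairs (m - 1) e2 (p + 2) =
      avoiding (V - S) (cylinder_edges (m - 1) \<union> antipodal_pairs e p \<union> ?K2)"
    unfolding cylinder_with_pairs_def pairs2 V_S Un_assoc ..
  then have "cylinder_with_pairs (m + 2) e p \<simeq> cylinder_with_pairs (m - 1) e2 (p + 2)"
    using reduced by simp
  moreover have "e2 ` ({..<p + 2} \<times> UNIV) \<subseteq> {m - 1<..} \<times> UNIV"
  proof
    fix v assume "v \<in> e2 ` ({..<p + 2} \<times> UNIV)"
    then have "v \<in> M \<or> v \<in> U" unfolding im2 by blast
    then have "m - 1 < fst v" using U[of v] by (auto simp: M_def)
    then show "v \<in> {m - 1<..} \<times> UNIV" by (simp add: mem_Times_iff)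
  qed
  ultimately show thesis
    using that inj2 by blast
qed

text \<open>
  The number \<open>m mod 3 mod 2\<close> of remaining rows is \<open>1\<close> if \<open>m\<close> is \<open>1\<close> modulo \<open>3\<close>, and \<open>0\<close> otherwise. The
  bound on the rows of the isolated edges keeps them off the cylinder.
\<close>

lemma cylinder_same_type_pairs:
  assumes "inj_on e ({..<p} \<times> UNIV)" "e ` ({..<p} \<times> UNIV) \<subseteq> {m<..} \<times> UNIV"
  shows "\<exists>e'. inj_on e' ({..<p + 2 * ((m + 1) div 3)} \<times> UNIV) \<and>
    e' ` ({..<p + 2 * ((m + 1) div 3)} \<times> UNIV) \<subseteq> {m mod 3 mod 2<..} \<times> UNIV \<and>
    cylinder_with_pairs m e p \<simeq> cylinder_with_pairs (m mod 3 mod 2) e' (p + 2 * ((m + 1) div 3))"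
  using assms
proof (induction m arbitrary: e p rule: less_induct)
  case (less m)
  show ?case
  proof (cases "m < 2")
    case True
    then have "m mod 3 mod 2 = m" "(m + 1) div 3 = 0" by auto
    then show ?thesis
      using less.prems by (intro exI[of _ e]) simp
  next
    case False
    define n where "n = m - 2"
    have m: "m = n + 2" using False by (simp add: n_def)
    obtain e1 where e1: "inj_on e1 ({..<p + 2} \<times> UNIV)"
        "e1 ` ({..<p + 2} \<times> UNIV) \<subseteq> {n - 1<..} \<times> UNIV"
        "cylinder_with_pairs m e p \<simeq> cylinder_with_pairs (n - 1) e1 (p + 2)"
      using cylinder_peel_three_rows[of e p n] less.prems unfolding m by blast
    have "(m + 1) div 3 = (n - 1 + 1) div 3 + 1 \<and> (n - 1) mod 3 mod 2 = m mod 3 mod 2"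
    proof (cases n)
      case (Suc j)
      then have "n - 1 = j" "m + 1 = (j + 1) + 3" "m = j + 3" by (simp_all add: m)
      then show ?thesis by (metis div_add_self2 mod_add_self2 zero_neq_numeral)
    qed (simp add: m)
    then have div_eq: "(m + 1) div 3 = (n - 1 + 1) div 3 + 1"
      and r: "(n - 1) mod 3 mod 2 = m mod 3 mod 2"
      by blast+
    have k: "p + 2 + 2 * ((n - 1 + 1) div 3) = p + 2 * ((m + 1) div 3)"
      unfolding div_eq by simp
    have lt: "n - 1 < m" by (simp add: m)
    obtain e2 where "inj_on e2 ({..<p + 2 * ((m + 1) div 3)} \<times> UNIV)"
        "e2 ` ({..<p + 2 * ((m + 1) div 3)} \<times> UNIV) \<subseteq> {m mod 3 mod 2<..} \<times> UNIV"
        "cylinder_with_pairs (n - 1) e1 (p + 2) \<simeq>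
          cylinder_with_pairs (m mod 3 mod 2) e2 (p + 2 * ((m + 1) div 3))"
      using less.IH[OF lt e1(1,2), unfolded k r] by blast
    then show ?thesis
      using same_type_trans[OF e1(3)] by blast
  qed
qed

section \<open>Spheres and wedges from the remaining rows\<close>

lemma cylinder_with_no_rows: "cylinder_with_pairs 0 e p = cross_polytope e p"
  by (simp add: cylinder_with_pairs_def cross_polytope_def cylinder_edges_def)

lemma cylinder_with_one_row:
  "cylinder_with_pairs 1 e p =
     avoiding ({(1, 1), (1, 2), (1, 3)} \<union> e ` ({..<p} \<times> UNIV))
       ({{(1, 1), (1, 2)}, {(1, 2), (1, 3)}, {(1, 1), (1, 3)}} \<union> antipodal_pairs e p)"
proof -
  have "{1..1 :: nat} \<times> {1..3} = {(1, 1), (1, 2), (1, 3 :: nat)}"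
    unfolding atLeastAtMost_1_3 by auto
  then show ?thesis
    by (simp add: cylinder_with_pairs_def cylinder_edges_def row_edges_def)
qed

lemma cylinder_three_same_type_pairs:
  obtains e where "inj_on e ({..<2 * ((m + 1) div 3)} \<times> UNIV)"
    "e ` ({..<2 * ((m + 1) div 3)} \<times> UNIV) \<subseteq> {m mod 3 mod 2<..} \<times> UNIV"
    "independence_complex (cylinder_graph m 3) \<simeq>
      cylinder_with_pairs (m mod 3 mod 2) e (2 * ((m + 1) div 3))"
proof -
  define e0 :: "nat \<times> bool \<Rightarrow> nat \<times> nat" where "e0 = undefined"
  have no_pairs: "cylinder_with_pairs m e0 0 = independence_complex (cylinder_graph m 3)"
    by (simp add: cylinder_with_pairs_def independence_complex_cylinder antipodal_pairs_def)
  have "inj_on e0 ({..<0} \<times> UNIV)" "e0 ` ({..<0} \<times> UNIV) \<subseteq> {m<..} \<times> UNIV"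
    by simp_all
  from cylinder_same_type_pairs[OF this, unfolded no_pairs add_0] show thesis
    by (elim exE conjE) (rule that)
qed

lemma independence_Z_eq_euler_sum: "independence_Z G = euler_sum (independence_complex G)"
  by (simp add: independence_Z_def euler_sum_def)

lemma cylinder_three_sphere:
  assumes "m \<ge> 1" "m mod 3 \<noteq> 1"
  shows "geometric_realization (independence_complex (cylinder_graph m 3))
      homotopy_equivalent_space nsphere (2 * ((m + 1) div 3) - 1)"
    and "independence_Z (cylinder_graph m 3) = 1"
proof -
  have "m mod 3 = 0 \<or> m mod 3 = 2" using assms(2) by auto
  then have r: "m mod 3 mod 2 = 0" by auto
  define q where "q = 2 * ((m + 1) div 3)"
  obtain e where e: "inj_on e ({..<q} \<times> UNIV)"
    "independence_complex (cylinder_graph m 3) \<simeq> cross_polytope e q"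
    using cylinder_three_same_type_pairs[of m] unfolding r cylinder_with_no_rows q_def by metis
  have "q > 0" unfolding q_def using assms by (cases "m = 1") (auto simp: div_greater_zero_iff)
  then have q: "Suc (q - 1) = q" "{..q - 1} = {..<q}" by auto
  have "geometric_realization (cross_polytope e q) homeomorphic_space nsphere (q - 1)"
    using cross_polytope_homeomorphic_nsphere[of e "q - 1"] e(1) unfolding q by blast
  then show "geometric_realization (independence_complex (cylinder_graph m 3))
      homotopy_equivalent_space nsphere (2 * ((m + 1) div 3) - 1)"
    using e(2) homeomorphic_imp_homotopy_equivalent_space homotopy_eqv_trans
    unfolding same_type_def q_def by blast
  show "independence_Z (cylinder_graph m 3) = 1"
    using e euler_sum_cross_polytope[OF e(1)]
    by (simp add: independence_Z_eq_euler_sum same_type_def q_def power_mult)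
qed

lemma pairs_of_three:
  assumes "distinct [x, y, z]"
  shows "{{a, b} |a b. a \<in> {x, y, z} \<and> b \<in> {x, y, z} \<and> a \<noteq> b} = {{x, y}, {y, z}, {x, z}}"
proof (rule equalityI)
  show "{{x, y}, {y, z}, {x, z}} \<subseteq> {{a, b} |a b. a \<in> {x, y, z} \<and> b \<in> {x, y, z} \<and> a \<noteq> b}"
  proof (intro insert_subsetI empty_subsetI)
    show "{x, y} \<in> {{a, b} |a b. a \<in> {x, y, z} \<and> b \<in> {x, y, z} \<and> a \<noteq> b}"
      and "{y, z} \<in> {{a, b} |a b. a \<in> {x, y, z} \<and> b \<in> {x, y, z} \<and> a \<noteq> b}"
      and "{x, z} \<in> {{a, b} |a b. a \<in> {x, y, z} \<and> b \<in> {x, y, z} \<and> a \<noteq> b}"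
      using assms by (simp_all, metis+)
  qed
qed (auto simp: insert_commute)

lemma cylinder_three_wedge:
  assumes "m mod 3 = 1"
  shows "geometric_realization (independence_complex (cylinder_graph m 3))
      homotopy_equivalent_space wedge_of_spheres 2 (2 * ((m + 1) div 3))"
    and "independence_Z (cylinder_graph m 3) = - 2"
proof -
  define q where "q = 2 * ((m + 1) div 3)"
  define U where "U e = e ` ({..<q} \<times> (UNIV :: bool set))" for e :: "nat \<times> bool \<Rightarrow> nat \<times> nat"
  let ?T = "{(1, 1), (1, 2), (1, 3)} :: (nat \<times> nat) set"
  let ?E = "{{(1, 1), (1, 2)}, {(1, 2), (1, 3)}, {(1, 1), (1, 3)}} :: (nat \<times> nat) set set"
  have r: "m mod 3 mod 2 = 1" using assms by simp
  obtain e where inj: "inj_on e ({..<q} \<times> UNIV)" and e: "U e \<subseteq> {1<..} \<times> UNIV"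
    and eq: "independence_complex (cylinder_graph m 3) \<simeq> avoiding (?T \<union> U e) (?E \<union> antipodal_pairs e q)"
    using cylinder_three_same_type_pairs[of m] unfolding r cylinder_with_one_row q_def U_def by metis
  have disj: "?T \<inter> U e = {}" using e by auto
  have "infinite (UNIV :: (nat \<times> nat) set)"
    by (simp add: finite_prod)
  then have "geometric_realization (avoiding (?T \<union> U e) (?E \<union> antipodal_pairs e q))
      homotopy_equivalent_space wedge_of_spheres 2 q"
    using disj unfolding U_def by (intro three_cones_homotopy_equivalent_wedge inj) auto
  then show "geometric_realization (independence_complex (cylinder_graph m 3))
      homotopy_equivalent_space wedge_of_spheres 2 (2 * ((m + 1) div 3))"
    using eq homotopy_eqv_trans unfolding same_type_def q_def by blast
  have "?E = {{a, b} |a b. a \<in> ?T \<and> b \<in> ?T \<and> a \<noteq> b}"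
    by (rule pairs_of_three[symmetric]) simp
  then have "euler_sum (avoiding (?T \<union> U e) (?E \<union> antipodal_pairs e q)) =
      (1 - int (card ?T)) * euler_sum (avoiding (U e) (antipodal_pairs e q))"
    using disj by (simp only:) (rule euler_sum_avoiding_join_points, auto simp: U_def antipodal_pairs_def)
  also have "\<dots> = - 2"
    using euler_sum_cross_polytope[OF inj] by (simp add: cross_polytope_def U_def q_def power_mult)
  finally show "independence_Z (cylinder_graph m 3) = - 2"
    using eq by (simp add: independence_Z_eq_euler_sum same_type_def)
qed

theorem proposition3p2:
  fixes m :: nat
  assumes "m \<ge> 1"
  shows "(m mod 3 = 0 \<longrightarrow>
            geometric_realization (independence_complex (cylinder_graph m 3))
              homotopy_equivalent_space nsphere (2 * m div 3 - 1)) \<and>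
         (m mod 3 = 1 \<longrightarrow>
            geometric_realization (independence_complex (cylinder_graph m 3))
              homotopy_equivalent_space wedge_of_spheres 2 (2 * (m - 1) div 3)) \<and>
         (m mod 3 = 2 \<longrightarrow>
            geometric_realization (independence_complex (cylinder_graph m 3))
              homotopy_equivalent_space nsphere (2 * (m - 2) div 3 + 1)) \<and>
         (m mod 3 = 0 \<longrightarrow> independence_Z (cylinder_graph m 3) = 1) \<and>
         (m mod 3 = 1 \<longrightarrow> independence_Z (cylinder_graph m 3) = - 2) \<and>
         (m mod 3 = 2 \<longrightarrow> independence_Z (cylinder_graph m 3) = 1)"
proof -
  have m: "m = 3 * (m div 3) + m mod 3" by simp
  have "2 * m div 3 - 1 = 2 * ((m + 1) div 3) - 1" if r: "m mod 3 = 0"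
  proof -
    obtain k where "m = 3 * k + 0" using m unfolding r by blast
    then show ?thesis by simp
  qed
  moreover have "2 * (m - 1) div 3 = 2 * ((m + 1) div 3)" if r: "m mod 3 = 1"
  proof -
    obtain k where "m = 3 * k + 1" using m unfolding r by blast
    then show ?thesis by simp
  qed
  moreover have "2 * (m - 2) div 3 + 1 = 2 * ((m + 1) div 3) - 1" if r: "m mod 3 = 2"
  proof -
    obtain k where "m = 3 * k + 2" using m unfolding r by blast
    then show ?thesis by simp
  qed
  ultimately show ?thesis
    using cylinder_three_sphere[OF assms] cylinder_three_wedge[of m] by auto
qed

end
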